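(* Consider the stationary M/G/1 queue with arrival rate $\lambda>0$ and service time $S\ge 0$, where $\mathbb{E}[S]>0$, $\mathbb{E}[S^3]<\infty$ and the load $\rho=\lambda\mathbb{E}[S]$ satisfies $0<\rho<1$. Let $W$ be its stationary waiting time, let $Z\sim\mathrm{Exp}(1)$, and let \[ \hat W=\frac{2\mathbb{E}[S]}{\mathbb{E}[S^2]}(1-\rho)W,\qquad \widetilde W=\frac1\rho\hat W . \] Then \[ d_{\mathrm W}(\mathcal L(\widetilde W),\mathcal L(Z))\le \frac{4\,\mathbb{E}[S^3]\,\mathbb{E}[S]}{3(\mathbb{E}[S^2])^2}\,\frac{1-\rho}{\rho}, \] and \[ 1-\rho\le d_{\mathrm W}(\mathcal L(\hat W),\mathcal L(Z))\le\bigg(1+\frac{4\,\mathbb{E}[S^3]\,\mathbb{E}[S]}{3(\mathbb{E}[S^2])^2}\bigg)(1-\rho). \] The $O(1-\rho)$ rate as $\rho\to1$ in the first of these bounds (the upper bound on $d_{\mathrm W}(\mathcal L(\widetilde W),\mathcal L(Z))$) is optimal.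
   Context: For non-negative random variables $U,V$, the Wasserstein distance is $d_{\mathrm W}(\mathcal L(U),\mathcal L(V))=\sup_{h\in\mathrm{Lip}(1)}|\mathbb{E}[h(U)]-\mathbb{E}[h(V)]|$, where $\mathrm{Lip}(1)=\{h:[0,\infty)\to\mathbb{R} : |h(x)-h(y)|\le|x-y|\ \forall x,y\ge0\}$; $\mathcal L(U)$ denotes the law of $U$. M/G/1 queue: a single-server queue with infinite buffer, in which inter-arrival times are i.i.d. $\mathrm{Exp}(\lambda)$ (rate $\lambda$), service times are i.i.d. copies of $S$ independent of the arrivals, and customers are served in order of arrival. Its stationary waiting time $W$ (excluding the customer's own service) has the stationary law of Lindley's recursion, that is, $W$ has the law of $\max_{i\ge0}\Sigma_i$, where $\Sigma_0=0$, $\Sigma_i=\sum_{j=1}^i(S_j-X_{j+1})$, the $S_j$ are i.i.d. copies of $S$, and the $X_j$ are i.i.d. $\mathrm{Exp}(\lambda)$ and independent of the $S_j$. *)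

theory Defs
  imports "HOL-Probability.Probability"
begin

abbreviation law :: "'a measure \<Rightarrow> ('a \<Rightarrow> real) \<Rightarrow> real measure" where
  "law M X \<equiv> distr M borel X"

definition exp_law :: "real \<Rightarrow> real measure" where
  "exp_law lam = density lborel (\<lambda>x. ennreal (exponential_density lam x))"

text \<open>
  Test functions live on the half-line only: their values on the negative reals are unconstrained
  (possibly not even measurable), so expectations are taken over \<open>{0..}\<close>, which carries all the
  mass of the law of a non-negative random variable. As Bochner integrals are total, the supremum
  is the Wasserstein distance for laws with finite mean, where every Lipschitz function is
  integrable.
\<close>

definition wasserstein :: "real measure \<Rightarrow> real measure \<Rightarrow> ereal" where
  "wasserstein \<mu> \<nu> =
     (SUP h \<in> {h :: real \<Rightarrow> real. 1-lipschitz_on {0..} h}.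
        ereal \<bar>(LINT x:{0..}|\<mu>. h x) - (LINT x:{0..}|\<nu>. h x)\<bar>)"

text \<open>
  A queue is given by a service time \<open>S\<close> on a probability space \<open>M\<close> and an arrival rate \<open>lam\<close>.
  A sample point of \<open>queue_space\<close> is a pair \<open>(s, x)\<close> consisting of the sequence of service times
  and the independent sequence of inter-arrival times.
\<close>

definition queue_space ::
    "'a measure \<Rightarrow> ('a \<Rightarrow> real) \<Rightarrow> real \<Rightarrow> ((nat \<Rightarrow> real) \<times> (nat \<Rightarrow> real)) measure" where
  "queue_space M S lam =
     (\<Pi>\<^sub>M j\<in>UNIV. law M S) \<Otimes>\<^sub>M (\<Pi>\<^sub>M j\<in>UNIV. exp_law lam)"

definition walk :: "(nat \<Rightarrow> real) \<times> (nat \<Rightarrow> real) \<Rightarrow> nat \<Rightarrow> real" where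
  "walk \<omega> i = (\<Sum>j=1..i. fst \<omega> j - snd \<omega> (j + 1))"

text \<open>
  For load below one the walk drifts to minus infinity, so almost surely this supremum is a
  maximum; on the null set where the walk is unbounded above, the value is an unspecified constant.
\<close>

definition waiting_time :: "(nat \<Rightarrow> real) \<times> (nat \<Rightarrow> real) \<Rightarrow> real" where
  "waiting_time \<omega> = (SUP i. walk \<omega> i)"

definition load :: "'a measure \<Rightarrow> ('a \<Rightarrow> real) \<Rightarrow> real \<Rightarrow> real" where
  "load M S lam = lam * (\<integral>\<omega>. S \<omega> \<partial>M)"

definition W_hat ::
    "'a measure \<Rightarrow> ('a \<Rightarrow> real) \<Rightarrow> real \<Rightarrow> (nat \<Rightarrow> real) \<times> (nat \<Rightarrow> real) \<Rightarrow> real" where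
  "W_hat M S lam \<omega> =
     2 * (\<integral>\<omega>. S \<omega> \<partial>M) / (\<integral>\<omega>. S \<omega> ^ 2 \<partial>M) * (1 - load M S lam) * waiting_time \<omega>"

definition W_tilde ::
    "'a measure \<Rightarrow> ('a \<Rightarrow> real) \<Rightarrow> real \<Rightarrow> (nat \<Rightarrow> real) \<times> (nat \<Rightarrow> real) \<Rightarrow> real" where
  "W_tilde M S lam \<omega> = 1 / load M S lam * W_hat M S lam \<omega>"

definition dist_hat :: "'a measure \<Rightarrow> ('a \<Rightarrow> real) \<Rightarrow> real \<Rightarrow> ereal" where
  "dist_hat M S lam = wasserstein (law (queue_space M S lam) (W_hat M S lam)) (exp_law 1)"

definition dist_tilde :: "'a measure \<Rightarrow> ('a \<Rightarrow> real) \<Rightarrow> real \<Rightarrow> ereal" where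
  "dist_tilde M S lam = wasserstein (law (queue_space M S lam) (W_tilde M S lam)) (exp_law 1)"

definition bound_const :: "'a measure \<Rightarrow> ('a \<Rightarrow> real) \<Rightarrow> real" where
  "bound_const M S =
     4 * (\<integral>\<omega>. S \<omega> ^ 3 \<partial>M) * (\<integral>\<omega>. S \<omega> \<partial>M) / (3 * (\<integral>\<omega>. S \<omega> ^ 2 \<partial>M) ^ 2)"

end

theory Submission
  imports Defs
begin

text \<open>
  Write \<open>W\<close> for the supremum of the walk. Averaging \<open>F + F' / lam\<close> over the exponential step of
  Lindley's recursion \<open>W = max 0 (W + S - X)\<close> in law undoes the convolution: if \<open>F' 0 = 0\<close>, then
  \<open>E (F W) + E (F' W) / lam = E (F (W + S))\<close>. For the running maxima, which increase, the cases
  \<open>F x = x ^ 2\<close> and \<open>F x = x ^ 3\<close> bound the first two moments uniformly, so \<open>W\<close> is almost surely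
  finite and square integrable and the identity passes to the limit; \<open>F x = x ^ 2\<close> then gives \<open>E W\<close>.

  For the upper bounds, let \<open>\<phi> x = E (h Z) - E (h (x + Z))\<close>, which solves
  \<open>\<phi>' - \<phi> = h - E (h Z)\<close>, vanishes at \<open>0\<close>, and has a 2-Lipschitz derivative when \<open>h\<close> is
  1-Lipschitz. Taking for \<open>F'\<close> a rescaled \<open>\<phi>\<close> and expanding \<open>F (W + S) - F W\<close> to second
  order in \<open>S\<close>, the main terms combine to \<open>E (h (W / E W)) - E (h Z)\<close>, and the remainder is
  controlled by \<open>E (S ^ 3)\<close>. The mean gives the lower bound. Optimality follows by testing with
  \<open>exp (- x)\<close>: taking for \<open>F'\<close> the function \<open>1 - exp (- x / E W)\<close> computes the Laplace transform of
  \<open>W / E W\<close> at 1, which exceeds \<open>1 / 2\<close> by a multiple of \<open>1 - \<rho>\<close>.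
\<close>

section \<open>Exponential laws and the Stein equation\<close>

lemma sets_exp_law [measurable_cong, simp]: "sets (exp_law lam) = sets borel"
  by (simp add: exp_law_def)

lemma space_exp_law [simp]: "space (exp_law lam) = UNIV"
  by (simp add: exp_law_def)

lemma prob_space_exp_law: "0 < lam \<Longrightarrow> prob_space (exp_law lam)"
  unfolding exp_law_def by (rule prob_space_exponential_density)

lemma integrable_exp_law_iff:
  fixes f :: "real \<Rightarrow> real"
  assumes "0 < lam" and [measurable]: "f \<in> borel_measurable borel"
  shows "integrable (exp_law lam) f \<longleftrightarrow> integrable lborel (\<lambda>x. exponential_density lam x * f x)"
  unfolding exp_law_def using assms
  by (subst integrable_density) (auto simp: exponential_density_nonneg)

lemma integral_exp_law:
  fixes f :: "real \<Rightarrow> real"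
  assumes "0 < lam" and [measurable]: "f \<in> borel_measurable borel"
  shows "(\<integral>x. f x \<partial>exp_law lam) = (\<integral>x. exponential_density lam x * f x \<partial>lborel)"
  unfolding exp_law_def using assms
  by (subst integral_density) (auto simp: exponential_density_nonneg)

lemma AE_exp_law_nonneg: "0 < lam \<Longrightarrow> AE x in exp_law lam. 0 \<le> x"
  unfolding exp_law_def by (subst AE_density) (auto simp: exponential_density_def)

lemma exp_law_mean:
  assumes "0 < lam"
  shows "integrable (exp_law lam) (\<lambda>x. x)" "(\<integral>x. x \<partial>exp_law lam) = 1 / lam"
proof -
  interpret E: prob_space "exp_law lam" by (rule prob_space_exp_law) fact
  have "distributed (exp_law lam) lborel (\<lambda>x. x) (exponential_density lam)"
    using assms by (auto simp: distributed_def exp_law_def distr_id2 exponential_density_nonneg)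
  from E.exponential_distributed_expectation[OF assms this]
  show *: "(\<integral>x. x \<partial>exp_law lam) = 1 / lam" .
  \<comment> \<open>A function that is not integrable has Bochner integral 0, so the nonzero value
    \<open>1 / lam\<close> already forces integrability.\<close>
  show "integrable (exp_law lam) (\<lambda>x. x)"
    using * assms not_integrable_integral_eq by fastforce
qed

text \<open>Tilting the density of rate 1 by \<open>exp (- x)\<close> gives half the density of rate
  2. The value is the reference point for the optimality claim.\<close>

lemma exp_law_one_integral_exp_minus: "(\<integral>x. exp (- x) \<partial>exp_law 1) = 1 / 2"
proof -
  interpret E: prob_space "exp_law 2" by (rule prob_space_exp_law) simp
  have "exponential_density 1 x * exp (- x) = exponential_density 2 x * (1 / 2)" for x :: real
    by (simp add: exponential_density_def mult_exp_exp)
  then have "(\<integral>x. exp (- x) \<partial>exp_law 1) = (\<integral>x. exponential_density 2 x * (1 / 2) \<partial>lborel)"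
    by (subst integral_exp_law) (simp_all only: zero_less_one, measurable)
  also have "\<dots> = (\<integral>x. 1 / 2 \<partial>exp_law 2)"
    by (subst integral_exp_law) auto
  also have "\<dots> = 1 / 2" using E.prob_space by simp
  finally show ?thesis .
qed

text \<open>For \<open>b\<close> between 0 and \<open>v\<close>, density times integrand is an exact
  derivative once \<open>F\<close> is normalised to vanish at 0. For \<open>b\<close> beyond
  \<open>v\<close> the reflected value is 0, where the normalised \<open>F\<close> and
  \<open>f\<close> both vanish, so nothing is left there.\<close>

lemma exp_law_integral_Lindley_step:
  fixes F f :: "real \<Rightarrow> real"
  assumes lam: "0 < lam" and v: "0 \<le> v"
    and F: "\<And>x. 0 \<le> x \<Longrightarrow> (F has_real_derivative f x) (at x)"
    and f: "continuous_on {0..} f" "f 0 = 0"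
  shows "(\<integral>b. F (max 0 (v - b)) + f (max 0 (v - b)) / lam \<partial>exp_law lam) = F v"
proof -
  interpret E: prob_space "exp_law lam" by (rule prob_space_exp_law) fact
  \<comment> \<open>Subtracting \<open>F 0\<close> removes the contribution of the reflection at 0;
    the constant is added back at the end, since the law has mass 1.\<close>
  define G where "G x = F x - F 0" for x
  have G: "(G has_real_derivative f x) (at x)" if "0 \<le> x" for x
    unfolding G_def using F[OF that] by (auto intro!: derivative_eq_intros)
  have contF: "continuous_on {0..} F"
    using F by (intro continuous_at_imp_continuous_on ballI) (auto intro: DERIV_isCont)
  \<comment> \<open>This is the derivative of \<open>- G (v - b) * exp (- lam * b)\<close>, whose
    boundary values are 0 at \<open>b = v\<close> and \<open>- G v\<close> at
    \<open>b = 0\<close>.\<close>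
  define k where "k b = (lam * G (v - b) + f (v - b)) * exp (- lam * b)" for b
  have bochner: "has_bochner_integral lborel (\<lambda>b. indicator {0..v} b *\<^sub>R k b)
      (- G (v - v) * exp (- lam * v) - (- G (v - 0) * exp (- lam * 0)))"
  proof (rule has_bochner_integral_FTC_Icc[OF v])
    fix b assume b: "0 \<le> b" "b \<le> v"
    have "((\<lambda>b. G (v - b)) has_real_derivative f (v - b) * (- 1)) (at b)"
      by (rule DERIV_chain2[OF G]) (use b in \<open>auto intro!: derivative_eq_intros\<close>)
    then have "((\<lambda>b. - G (v - b) * exp (- lam * b)) has_real_derivative k b) (at b)"
      unfolding k_def by (auto intro!: derivative_eq_intros simp: algebra_simps)
    then show "((\<lambda>b. - G (v - b) * exp (- lam * b)) has_vector_derivative k b) (at b within {0..v})"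
      by (simp add: has_real_derivative_iff_has_vector_derivative has_vector_derivative_at_within)
  next
    have "continuous_on {0..v} (\<lambda>b. f (v - b))" "continuous_on {0..v} (\<lambda>b. F (v - b))"
      by (auto intro!: continuous_on_compose2[OF f(1)] continuous_on_compose2[OF contF] continuous_intros)
    then show "continuous_on {0..v} k"
      unfolding k_def G_def by (intro continuous_intros)
  qed
  have meas: "(\<lambda>x. G (max 0 (v - x)) + f (max 0 (v - x)) / lam) \<in> borel_measurable borel"
    unfolding G_def using lam
    by (intro borel_measurable_continuous_onI continuous_intros
       continuous_on_compose2[OF f(1)] continuous_on_compose2[OF contF]) auto
  have eq: "exponential_density lam x * (G (max 0 (v - x)) + f (max 0 (v - x)) / lam)
      = indicator {0..v} x *\<^sub>R k x" for x
  proof (cases "0 \<le> x \<and> x \<le> v")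
    case True
    then show ?thesis using lam
      by (simp add: exponential_density_def k_def field_simps)
  next
    case False
    then show ?thesis
      by (auto simp: exponential_density_def G_def f max_def)
  qed
  have int: "integrable (exp_law lam) (\<lambda>b. G (max 0 (v - b)) + f (max 0 (v - b)) / lam)"
    by (subst integrable_exp_law_iff[OF lam meas]) (use bochner eq in \<open>auto simp: has_bochner_integral_iff\<close>)
  have "(\<integral>b. G (max 0 (v - b)) + f (max 0 (v - b)) / lam \<partial>exp_law lam) = G v"
    by (subst integral_exp_law[OF lam meas])
       (use bochner eq in \<open>auto simp: has_bochner_integral_iff G_def\<close>)
  moreover have "(\<integral>b. F (max 0 (v - b)) + f (max 0 (v - b)) / lam \<partial>exp_law lam)
     = (\<integral>b. F 0 + (G (max 0 (v - b)) + f (max 0 (v - b)) / lam) \<partial>exp_law lam)"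
    by (simp add: G_def algebra_simps)
  moreover have "\<dots> = F 0 + (\<integral>b. G (max 0 (v - b)) + f (max 0 (v - b)) / lam \<partial>exp_law lam)"
    using int E.prob_space by (subst Bochner_Integration.integral_add) auto
  ultimately show ?thesis by (simp add: G_def)
qed

section \<open>Lipschitz functions and the Stein equation of the exponential law\<close>

lemma lipschitz_real_bound:
  fixes h :: "real \<Rightarrow> real"
  assumes "L-lipschitz_on UNIV h"
  shows "\<bar>h x - h y\<bar> \<le> L * \<bar>x - y\<bar>"
  using lipschitz_onD[OF assms, of x y] by (auto simp: dist_real_def)

lemma lipschitz_borel_measurable:
  fixes h :: "real \<Rightarrow> real"
  assumes "L-lipschitz_on UNIV h"
  shows "h \<in> borel_measurable borel"
  using lipschitz_on_continuous_on[OF assms] by (rule borel_measurable_continuous_onI)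

lemma integrable_lipschitz:
  fixes h :: "real \<Rightarrow> real"
  assumes "finite_measure M" "L-lipschitz_on UNIV h" "integrable M X"
  shows "integrable M (\<lambda>x. h (X x))"
proof -
  interpret finite_measure M by fact
  note [measurable] = lipschitz_borel_measurable[OF assms(2)] borel_measurable_integrable[OF assms(3)]
  have "\<bar>h y\<bar> \<le> \<bar>h 0\<bar> + \<bar>L\<bar> * \<bar>y\<bar>" for y
    using lipschitz_real_bound[OF assms(2), of y 0] lipschitz_on_nonneg[OF assms(2)] by auto
  then show ?thesis
    by (intro Bochner_Integration.integrable_bound[of M "\<lambda>x. \<bar>h 0\<bar> + \<bar>L\<bar> * \<bar>X x\<bar>" "\<lambda>x. h (X x)"])
       (use assms(3) in auto)
qed

text \<open>Solutions of the Stein equation differ by multiples of \<open>exp x\<close>. This one is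
  written as a difference of means, from which its value at 0 and its Lipschitz bound can be read
  off.\<close>

definition stein_solution :: "(real \<Rightarrow> real) \<Rightarrow> real \<Rightarrow> real" where
  "stein_solution h x = (\<integral>z. h z \<partial>exp_law 1) - (\<integral>z. h (x + z) \<partial>exp_law 1)"

lemma integrable_exp_law_shift:
  fixes h :: "real \<Rightarrow> real"
  assumes "L-lipschitz_on UNIV h"
  shows "integrable (exp_law 1) (\<lambda>z. h (x + z))"
proof -
  interpret E: prob_space "exp_law 1" by (rule prob_space_exp_law) simp
  show ?thesis using exp_law_mean(1)[of 1]
    by (intro integrable_lipschitz[OF E.finite_measure_axioms assms]) auto
qed

text \<open>Both shifted means are taken with the same exponential variable, so the Lipschitz bound
  of \<open>h\<close> holds pointwise under the integral.\<close>

lemma stein_solution_lipschitz: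
  assumes "L-lipschitz_on UNIV h"
  shows "L-lipschitz_on UNIV (stein_solution h)"
proof (rule lipschitz_onI)
  interpret E: prob_space "exp_law 1" by (rule prob_space_exp_law) simp
  fix x y :: real
  note int = integrable_exp_law_shift[OF assms]
  have "dist (stein_solution h x) (stein_solution h y) = \<bar>\<integral>z. h (x + z) - h (y + z) \<partial>exp_law 1\<bar>"
    using int by (simp add: stein_solution_def dist_real_def)
  also have "\<dots> \<le> (\<integral>z. \<bar>h (x + z) - h (y + z)\<bar> \<partial>exp_law 1)" by (rule integral_abs_bound)
  also have "\<dots> \<le> (\<integral>z. L * \<bar>x - y\<bar> \<partial>exp_law 1)"
  proof (rule integral_mono)
    show "\<bar>h (x + z) - h (y + z)\<bar> \<le> L * \<bar>x - y\<bar>" for z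
      using lipschitz_real_bound[OF assms, of "x + z" "y + z"] by simp
  qed (use int in auto)
  finally show "dist (stein_solution h x) (stein_solution h y) \<le> L * dist x y"
    using E.prob_space by (simp add: dist_real_def)
qed (rule lipschitz_on_nonneg[OF assms])

lemma stein_solution_0 [simp]: "stein_solution h 0 = 0"
  by (simp add: stein_solution_def)

text \<open>The substitution \<open>t = y + z\<close> turns the shifted mean into
  \<open>exp y\<close> times the tail integral of \<open>h t * exp (- t)\<close> from
  \<open>y\<close>. The variable then occurs only in a smooth factor and in a limit of integration,
  so continuity of \<open>h\<close> is enough to differentiate.\<close>

lemma stein_solution_deriv:
  assumes h: "L-lipschitz_on UNIV h"
  shows "(stein_solution h has_real_derivative
           stein_solution h x + h x - (\<integral>z. h z \<partial>exp_law 1)) (at x)"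
proof -
  note [measurable] = lipschitz_borel_measurable[OF h]
  define g where "g t = h t * exp (- t)" for t
  define G where "G y = (\<integral>t. indicator {y..} t * g t \<partial>lborel)" for y
  have eq: "exponential_density 1 z * h (y + z) = exp y * (indicator {y..} (y + 1 * z) * g (y + 1 * z))" for y z
    by (auto simp: exponential_density_def g_def indicator_def mult_exp_exp)
  have G: "(\<integral>z. h (y + z) \<partial>exp_law 1) = exp y * G y" for y
    unfolding G_def
    by (subst integral_exp_law, simp, measurable)
       (subst lborel_integral_real_affine[where c=1 and t=y], auto simp: eq)
  have int: "integrable lborel (\<lambda>t. indicator {y..} t * g t)" for y
  proof -
    have "integrable lborel (\<lambda>z. exponential_density 1 z * h (y + z))"
      using integrable_exp_law_shift[OF h, of y] by (subst (asm) integrable_exp_law_iff) auto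
    then have "integrable lborel (\<lambda>z. exp y * (indicator {y..} (y + 1 * z) * g (y + 1 * z)))"
      by (simp only: eq)
    then have "integrable lborel (\<lambda>z. (indicator {y..} (y + 1 * z) * g (y + 1 * z)))"
      by (subst (asm) integrable_mult_left_iff) auto
    then show ?thesis
      by (subst (asm) lborel_integrable_real_affine_iff) auto
  qed
  have cont: "continuous_on A g" for A
    unfolding g_def using lipschitz_on_continuous_on[OF h]
    by (auto intro!: continuous_intros intro: continuous_on_subset)
  \<comment> \<open>Near \<open>x\<close> the tail integral is a constant minus an integral over a
    compact interval. The base point \<open>x - 1\<close> keeps \<open>x\<close> in the interior, so
    the fundamental theorem of calculus gives a two-sided derivative.\<close>
  have diff: "G (x - 1) - G y = integral {x - 1..y} g" if "x - 1 \<le> y" for y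
  proof -
    have "G (x - 1) - G y = (\<integral>t. indicator {x - 1..} t * g t - indicator {y..} t * g t \<partial>lborel)"
      unfolding G_def using int by simp
    also have "\<dots> = (LINT t:{x - 1..<y}|lborel. g t)"
      unfolding set_lebesgue_integral_def
      by (rule Bochner_Integration.integral_cong) (use that in \<open>auto simp: indicator_def\<close>)
    also have "\<dots> = integral {x - 1..<y} g"
    proof (rule set_borel_integral_eq_integral)
      have "set_integrable lborel {x - 1..y} g"
        using cont by (rule borel_integrable_atLeastAtMost')
      then show "set_integrable lborel {x - 1..<y} g"
        by (rule set_integrable_subset) auto
    qed
    also have "\<dots> = integral {x - 1..y} g"
      by (intro integral_subset_negligible negligible_subset[OF negligible_sing[of y]]) auto
    finally show ?thesis .
  qed
  have "((\<lambda>y. integral {x - 1..y} g) has_real_derivative g x) (at x within {x - 1..x + 1})"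
    by (rule integral_has_real_derivative) (use cont in auto)
  then have "((\<lambda>y. integral {x - 1..y} g) has_real_derivative g x) (at x)"
    by (subst (asm) at_within_interior) auto
  then have "((\<lambda>y. G (x - 1) - integral {x - 1..y} g) has_real_derivative - g x) (at x)"
    by (auto intro!: derivative_eq_intros)
  then have "(G has_real_derivative - g x) (at x)"
    by (rule has_field_derivative_transform_within_open[where S="{x - 1<..}"])
       (use diff in \<open>auto simp: algebra_simps\<close>)
  then have "((\<lambda>y. (\<integral>z. h z \<partial>exp_law 1) - exp y * G y) has_real_derivative
      - (exp x * G x + exp x * (- g x))) (at x)"
    by (auto intro!: derivative_eq_intros)
  also have "(\<lambda>y. (\<integral>z. h z \<partial>exp_law 1) - exp y * G y) = stein_solution h"
    by (auto simp: stein_solution_def G)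
  also have "- (exp x * G x + exp x * (- g x)) = stein_solution h x + h x - (\<integral>z. h z \<partial>exp_law 1)"
    by (simp add: stein_solution_def G g_def exp_minus)
  finally show ?thesis .
qed

text \<open>The Lipschitz bound on \<open>f'\<close> is integrated twice. Each integration is
  phrased as monotonicity of the difference from a comparison polynomial in the increment, and the
  sign \<open>\<sigma>\<close> treats the upper and lower estimates at once.\<close>

lemma taylor2_lipschitz_bound:
  fixes F f f' :: "real \<Rightarrow> real"
  assumes F: "\<And>x. 0 \<le> x \<Longrightarrow> (F has_real_derivative f x) (at x)"
    and f: "\<And>x. 0 \<le> x \<Longrightarrow> (f has_real_derivative f' x) (at x)"
    and lip: "\<And>x y. 0 \<le> x \<Longrightarrow> x \<le> y \<Longrightarrow> \<bar>f' y - f' x\<bar> \<le> K * (y - x)"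
    and w: "0 \<le> w" and s: "0 \<le> s"
  shows "\<bar>F (w + s) - F w - s * f w - s\<^sup>2 / 2 * f' w\<bar> \<le> K * s ^ 3 / 6"
proof -
  have sh: "((\<lambda>u. g (w + u)) has_real_derivative g' (w + u)) (at u)"
    if "\<And>x. 0 \<le> x \<Longrightarrow> (g has_real_derivative g' x) (at x)" "0 \<le> u" for u and g g' :: "real \<Rightarrow> real"
  proof -
    have "((\<lambda>u. g (w + u)) has_real_derivative g' (w + u) * 1) (at u)"
      by (rule DERIV_chain2[where g="\<lambda>u. w + u"], rule that(1))
         (use w that(2) in \<open>auto intro!: derivative_eq_intros\<close>)
    then show ?thesis by simp
  qed
  have one: "\<sigma> * (f (w + u) - f w - u * f' w) \<le> K * u\<^sup>2 / 2" if "0 \<le> u" "\<bar>\<sigma>\<bar> = 1" for u \<sigma> :: real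
  proof -
    let ?d = "\<lambda>u. \<sigma> * (f (w + u) - f w - u * f' w) - K * u\<^sup>2 / 2"
    have "?d u \<le> ?d 0"
    proof (rule DERIV_nonpos_imp_nonincreasing[OF that(1)])
      fix t assume t: "0 \<le> t" "t \<le> u"
      have "(?d has_real_derivative \<sigma> * (f' (w + t) - f' w) - K * t) (at t)"
        using sh[OF f, of t] t by (auto intro!: derivative_eq_intros simp: power2_eq_square)
      moreover have "\<sigma> * (f' (w + t) - f' w) - K * t \<le> 0"
        using lip[of w "w + t"] w t that(2) by (auto simp: abs_if split: if_splits)
      ultimately show "\<exists>y. (?d has_real_derivative y) (at t) \<and> y \<le> 0" by blast
    qed
    then show ?thesis by simp
  qed
  have two: "\<sigma> * (F (w + s) - F w - s * f w - s\<^sup>2 / 2 * f' w) \<le> K * s ^ 3 / 6" if "\<bar>\<sigma>\<bar> = 1" for \<sigma> :: real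
  proof -
    let ?d = "\<lambda>u. \<sigma> * (F (w + u) - F w - u * f w - u\<^sup>2 / 2 * f' w) - K * u ^ 3 / 6"
    have "?d s \<le> ?d 0"
    proof (rule DERIV_nonpos_imp_nonincreasing[OF s])
      fix t assume t: "0 \<le> t" "t \<le> s"
      have "(?d has_real_derivative \<sigma> * (f (w + t) - f w - t * f' w) - K * t\<^sup>2 / 2) (at t)"
        using sh[OF F, of t] t
        by (auto intro!: derivative_eq_intros simp: power2_eq_square)
      with one[of t \<sigma>] t that
      show "\<exists>y. (?d has_real_derivative y) (at t) \<and> y \<le> 0" by force
    qed
    then show ?thesis by simp
  qed
  from two[of 1] two[of "- 1"] show ?thesis
    unfolding abs_le_iff by simp
qed

section \<open>The random walk and its running maximum\<close>

text \<open>
  The walk re-indexed to start at \<open>0\<close> in both sequences, so that splitting off the first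
  coordinates is a shift.
\<close>

definition partial_walk :: "(nat \<Rightarrow> real) \<times> (nat \<Rightarrow> real) \<Rightarrow> nat \<Rightarrow> real" where
  "partial_walk \<omega> i = (\<Sum>j<i. fst \<omega> j - snd \<omega> j)"

definition walk_max :: "nat \<Rightarrow> (nat \<Rightarrow> real) \<times> (nat \<Rightarrow> real) \<Rightarrow> real" where
  "walk_max n \<omega> = Max (partial_walk \<omega> ` {..n})"

definition walk_sup :: "(nat \<Rightarrow> real) \<times> (nat \<Rightarrow> real) \<Rightarrow> real" where
  "walk_sup \<omega> = (SUP i. partial_walk \<omega> i)"

lemma walk_max_nonneg: "0 \<le> walk_max n \<omega>"
  unfolding walk_max_def by (rule Max_ge) (auto simp: partial_walk_def image_iff intro: bexI[of _ 0])

lemma walk_max_0 [simp]: "walk_max 0 \<omega> = 0"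
  by (simp add: walk_max_def partial_walk_def)

lemma walk_max_Suc_le: "walk_max n \<omega> \<le> walk_max (Suc n) \<omega>"
  unfolding walk_max_def by (rule Max_mono) auto

lemma incseq_walk_max: "incseq (\<lambda>n. walk_max n \<omega>)"
  by (rule incseq_SucI) (rule walk_max_Suc_le)

lemma partial_walk_Suc:
  "partial_walk (case_nat a s, case_nat b x) (Suc i) = a - b + partial_walk (s, x) i"
  by (simp add: partial_walk_def sum.lessThan_Suc_shift del: sum.lessThan_Suc)

text \<open>Pathwise Lindley recursion. The new step is put in front: the maximum is the starting
  value 0 or the first step plus the maximum of the remaining walk, and that walk uses other
  coordinates, which yields independence below.\<close>

lemma walk_max_Suc:
  "walk_max (Suc n) (case_nat a s, case_nat b x) = max 0 (a + walk_max n (s, x) - b)"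
proof -
  have *: "partial_walk (case_nat a s, case_nat b x) ` {..Suc n}
      = insert 0 ((\<lambda>r. a - b + r) ` (partial_walk (s, x) ` {..n}))"
    by (simp add: atMost_Suc_eq_insert_0 image_image partial_walk_Suc) (simp add: partial_walk_def)
  have "mono (\<lambda>r. a - b + r)" by (simp add: mono_def)
  then have "Max ((\<lambda>r. a - b + r) ` (partial_walk (s, x) ` {..n})) = a - b + walk_max n (s, x)"
    unfolding walk_max_def by (subst mono_Max_commute) auto
  then show ?thesis
    unfolding walk_max_def[of "Suc n"] * by (subst Max_insert) (auto simp: algebra_simps)
qed

text \<open>The running maxima increase, and their supremum is that of the walk; boundedness is what
  keeps both real suprema meaningful.\<close>

lemma walk_max_LIMSEQ:
  assumes "bdd_above (range (\<lambda>n. walk_max n \<omega>))"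
  shows "(\<lambda>n. walk_max n \<omega>) \<longlonglongrightarrow> walk_sup \<omega>"
proof -
  have le: "partial_walk \<omega> i \<le> walk_max i \<omega>" for i
    unfolding walk_max_def by (rule Max_ge) auto
  have bdd: "bdd_above (range (partial_walk \<omega>))"
    using assms le unfolding bdd_above_def by (auto simp: image_iff) (meson order_trans)
  have "(SUP n. walk_max n \<omega>) = walk_sup \<omega>"
  proof (rule antisym)
    show "(SUP n. walk_max n \<omega>) \<le> walk_sup \<omega>"
      unfolding walk_sup_def walk_max_def
      by (intro cSUP_least Max.boundedI) (auto intro!: cSUP_upper bdd)
    show "walk_sup \<omega> \<le> (SUP n. walk_max n \<omega>)"
      unfolding walk_sup_def using le assms by (intro cSUP_mono) auto
  qed
  with LIMSEQ_incseq_SUP[OF assms incseq_walk_max] show ?thesis by simp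
qed

text \<open>
  \<open>Sup\<close> of an unbounded set of reals is an unspecified constant, the same for all such sets; hence
  pointwise suprema are measurable without any boundedness assumption.
\<close>

lemma Sup_real_not_bdd:
  fixes X Y :: "real set"
  assumes "\<not> bdd_above X" "\<not> bdd_above Y"
  shows "Sup X = Sup Y"
proof -
  have "(\<lambda>z. \<forall>x\<in>X. x \<le> z) = (\<lambda>z. \<forall>x\<in>Y. x \<le> z)"
    using assms by (auto simp: bdd_above_def fun_eq_iff)
  then show ?thesis by (simp add: Sup_real_def)
qed

lemma borel_measurable_SUP_real:
  fixes f :: "nat \<Rightarrow> 'a \<Rightarrow> real"
  assumes [measurable]: "\<And>i. f i \<in> borel_measurable M"
  shows "(\<lambda>x. SUP i. f i x) \<in> borel_measurable M"
proof -
  define B where "B x \<longleftrightarrow> (\<exists>k::nat. \<forall>i. f i x \<le> real k)" for x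
  have [measurable]: "Measurable.pred M B" unfolding B_def by measurable
  have B: "B x \<longleftrightarrow> bdd_above (range (\<lambda>i. f i x))" for x
    unfolding B_def bdd_above_def by (auto) (meson order_trans real_arch_simple)
  \<comment> \<open>Off \<open>B\<close> the inner family is replaced by 0, so that it is bounded
    above at every point, as the measurability rule for conditionally complete suprema demands;
    there the true value is the constant \<open>Sup UNIV\<close>.\<close>
  have "(\<lambda>x. if B x then SUP i. if B x then f i x else 0 else Sup UNIV) \<in> borel_measurable M"
  proof (intro measurable_If borel_measurable_cSUP)
    show "bdd_above ((\<lambda>i. if B x then f i x else 0) ` UNIV)" for x
      using B by (cases "B x") auto
  qed auto
  also have "(\<lambda>x. if B x then SUP i. if B x then f i x else 0 else Sup UNIV) = (\<lambda>x. SUP i. f i x)"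
  proof
    fix x
    have "\<not> bdd_above (UNIV :: real set)"
      by (auto simp: bdd_above_def) (meson gt_ex not_le)
    then show "(if B x then SUP i. if B x then f i x else 0 else Sup UNIV) = (SUP i. f i x)"
      using B[of x] by (auto intro: Sup_real_not_bdd)
  qed
  finally show ?thesis .
qed

text \<open>With one factor constantly 1 this also covers functions of a single coordinate, so one
  rule expands every moment of a sum of independent variables below.\<close>

lemma (in pair_sigma_finite) product_integrable_mult:
  fixes f :: "'a \<Rightarrow> real" and g :: "'b \<Rightarrow> real"
  assumes f: "integrable M1 f" and g: "integrable M2 g"
  shows "integrable (M1 \<Otimes>\<^sub>M M2) (\<lambda>p. f (fst p) * g (snd p))"
    "(\<integral>p. f (fst p) * g (snd p) \<partial>(M1 \<Otimes>\<^sub>M M2)) = (\<integral>x. f x \<partial>M1) * (\<integral>y. g y \<partial>M2)"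
proof -
  note [measurable] = borel_measurable_integrable[OF f] borel_measurable_integrable[OF g]
  show *: "integrable (M1 \<Otimes>\<^sub>M M2) (\<lambda>p. f (fst p) * g (snd p))"
  proof (rule Fubini_integrable)
    have "(\<lambda>x. \<integral>y. norm (f (fst (x, y)) * g (snd (x, y))) \<partial>M2) = (\<lambda>x. \<bar>f x\<bar> * (\<integral>y. \<bar>g y\<bar> \<partial>M2))"
      by (simp add: abs_mult)
    then show "integrable M1 (\<lambda>x. \<integral>y. norm (f (fst (x, y)) * g (snd (x, y))) \<partial>M2)"
      using f by simp
  qed (use g in auto)
  show "(\<integral>p. f (fst p) * g (snd p) \<partial>(M1 \<Otimes>\<^sub>M M2)) = (\<integral>x. f x \<partial>M1) * (\<integral>y. g y \<partial>M2)"
    by (subst integral_fst'[OF *, symmetric]) simp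
qed

text \<open>Formulated for the law of the service time. Stability is left out here: the facts about
  finitely many steps hold for every load.\<close>

locale mg1 =
  fixes L :: "real measure" and lam :: real
  assumes prob_L: "prob_space L" and sets_L [measurable_cong, simp]: "sets L = sets borel"
    and L_nonneg: "AE a in L. 0 \<le> a"
    and L_int3: "integrable L (\<lambda>a. a ^ 3)"
    and lam: "0 < lam"
begin

abbreviation "services \<equiv> (\<Pi>\<^sub>M j\<in>(UNIV::nat set). L)"
abbreviation "arrivals \<equiv> (\<Pi>\<^sub>M j\<in>(UNIV::nat set). exp_law lam)"
abbreviation "Q \<equiv> services \<Otimes>\<^sub>M arrivals"

sublocale L: prob_space L by (rule prob_L)
sublocale E: prob_space "exp_law lam" by (rule prob_space_exp_law) (rule lam)
sublocale Ls: sequence_space L ..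
sublocale Es: sequence_space "exp_law lam" ..
sublocale Q: pair_prob_space services arrivals ..
sublocale LQ: pair_prob_space L Q ..
sublocale LQE: pair_prob_space "L \<Otimes>\<^sub>M Q" "exp_law lam" ..

lemma space_L [simp]: "space L = UNIV"
  using sets_eq_imp_space_eq[OF sets_L] by simp

text \<open>The exponential step is the last factor of the product, so that it can be integrated out
  first, with the service time and the rest of the walk held fixed.\<close>

definition prepend ::
    "(real \<times> (nat \<Rightarrow> real) \<times> (nat \<Rightarrow> real)) \<times> real \<Rightarrow> (nat \<Rightarrow> real) \<times> (nat \<Rightarrow> real)" where
  "prepend p = (case_nat (fst (fst p)) (fst (snd (fst p))), case_nat (snd p) (snd (snd (fst p))))"

lemma measurable_prepend [measurable]: "prepend \<in> (L \<Otimes>\<^sub>M Q) \<Otimes>\<^sub>M exp_law lam \<rightarrow>\<^sub>M Q"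
  unfolding prepend_def
  by (rule measurable_Pair; rule measurable_case_nat') measurable

text \<open>Putting an independent coordinate in front of an i.i.d. sequence preserves its law.
  Applied to both sequences this gives the claim, after Fubini has brought the four integrations
  into the order in which each new coordinate meets its own sequence.\<close>

lemma Q_decompose:
  "distr ((L \<Otimes>\<^sub>M Q) \<Otimes>\<^sub>M exp_law lam) Q
     prepend = Q" (is "distr ?P Q ?T = Q")
proof (rule measure_eqI)
  have m1 [measurable]: "(\<lambda>(a, s). case_nat a s) \<in> L \<Otimes>\<^sub>M services \<rightarrow>\<^sub>M services"
    and m2 [measurable]: "(\<lambda>(b, x). case_nat b x) \<in> exp_law lam \<Otimes>\<^sub>M arrivals \<rightarrow>\<^sub>M arrivals"
    by measurable
  fix A assume "A \<in> sets (distr ?P Q ?T)"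
  then have A [measurable]: "A \<in> sets Q" by simp
  have "emeasure (distr ?P Q ?T) A = (\<integral>\<^sup>+p. indicator A (?T p) \<partial>?P)"
    by (subst nn_integral_indicator[symmetric], simp, subst nn_integral_distr) auto
  also have "\<dots> = (\<integral>\<^sup>+a. \<integral>\<^sup>+s. \<integral>\<^sup>+x. \<integral>\<^sup>+b. indicator A (case_nat a s, case_nat b x) \<partial>exp_law lam \<partial>arrivals \<partial>services \<partial>L)"
    by (subst E.nn_integral_fst[symmetric], measurable)
       (subst Q.nn_integral_fst[symmetric], measurable,
        subst Es.P.nn_integral_fst[symmetric], measurable, simp add: prepend_def)
  \<comment> \<open>The new inter-arrival time \<open>b\<close> must be integrated outside its tail
    \<open>x\<close>, which is the order required by \<open>Es.PiM_iter\<close>.\<close>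
  also have "\<dots> = (\<integral>\<^sup>+a. \<integral>\<^sup>+s. \<integral>\<^sup>+b. \<integral>\<^sup>+x. indicator A (case_nat a s, case_nat b x) \<partial>arrivals \<partial>exp_law lam \<partial>services \<partial>L)"
  proof (intro nn_integral_cong)
    fix a s assume as: "a \<in> space L" "s \<in> space services"
    interpret pair_sigma_finite "exp_law lam" arrivals ..
    note [measurable] = as
    show "(\<integral>\<^sup>+x. \<integral>\<^sup>+b. indicator A (case_nat a s, case_nat b x) \<partial>exp_law lam \<partial>arrivals)
        = (\<integral>\<^sup>+b. \<integral>\<^sup>+x. indicator A (case_nat a s, case_nat b x) \<partial>arrivals \<partial>exp_law lam)"
      by (rule Fubini') measurable
  qed
  also have "\<dots> = (\<integral>\<^sup>+a. \<integral>\<^sup>+s. \<integral>\<^sup>+y. indicator A (case_nat a s, y) \<partial>distr (exp_law lam \<Otimes>\<^sub>M arrivals) arrivals (\<lambda>(b, x). case_nat b x) \<partial>services \<partial>L)"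
  proof (intro nn_integral_cong)
    fix a s assume as: "a \<in> space L" "s \<in> space services"
    have [measurable]: "case_nat a s \<in> space services"
      using as by (auto simp: space_PiM)
    show "(\<integral>\<^sup>+b. \<integral>\<^sup>+x. indicator A (case_nat a s, case_nat b x) \<partial>arrivals \<partial>exp_law lam)
       = (\<integral>\<^sup>+y. indicator A (case_nat a s, y) \<partial>distr (exp_law lam \<Otimes>\<^sub>M arrivals) arrivals (\<lambda>(b, x). case_nat b x))"
      by (subst nn_integral_distr[OF m2], measurable, subst Es.P.nn_integral_fst[symmetric], measurable)
  qed
  also have "\<dots> = (\<integral>\<^sup>+a. \<integral>\<^sup>+s. \<integral>\<^sup>+y. indicator A (case_nat a s, y) \<partial>arrivals \<partial>services \<partial>L)"
    by (simp only: Es.PiM_iter)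
  also have "\<dots> = (\<integral>\<^sup>+z. \<integral>\<^sup>+y. indicator A (z, y) \<partial>arrivals \<partial>distr (L \<Otimes>\<^sub>M services) services (\<lambda>(a, s). case_nat a s))"
    by (subst nn_integral_distr[OF m1], measurable, subst Ls.P.nn_integral_fst[symmetric], measurable)
  also have "\<dots> = (\<integral>\<^sup>+z. \<integral>\<^sup>+y. indicator A (z, y) \<partial>arrivals \<partial>services)"
    by (simp only: Ls.PiM_iter)
  also have "\<dots> = emeasure Q A"
    by (subst Es.P.nn_integral_fst) auto
  finally show "emeasure (distr ?P Q ?T) A = emeasure Q A" .
qed simp

lemma measurable_partial_walk [measurable]: "(\<lambda>\<omega>. partial_walk \<omega> i) \<in> borel_measurable Q"
  unfolding partial_walk_def by measurable

lemma measurable_walk_max [measurable]: "walk_max n \<in> borel_measurable Q"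
  unfolding walk_max_def by measurable

lemma measurable_walk_sup [measurable]: "walk_sup \<in> borel_measurable Q"
  unfolding walk_sup_def by (rule borel_measurable_SUP_real) measurable

lemma distr_walk_max_Suc:
  "distr Q borel (walk_max (Suc n)) =
    distr ((L \<Otimes>\<^sub>M Q) \<Otimes>\<^sub>M exp_law lam) borel
      (\<lambda>p. max 0 (fst (fst p) + walk_max n (snd (fst p)) - snd p))"
proof -
  have "distr Q borel (walk_max (Suc n)) =
     distr (distr ((L \<Otimes>\<^sub>M Q) \<Otimes>\<^sub>M exp_law lam) Q
     prepend) borel (walk_max (Suc n))"
    by (simp only: Q_decompose)
  also have "\<dots> = distr ((L \<Otimes>\<^sub>M Q) \<Otimes>\<^sub>M exp_law lam) borel
     (walk_max (Suc n) \<circ> prepend)"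
    by (rule distr_distr) measurable
  also have "walk_max (Suc n) \<circ> prepend
      = (\<lambda>p. max 0 (fst (fst p) + walk_max n (snd (fst p)) - snd p))"
    by (auto simp: fun_eq_iff prepend_def walk_max_Suc)
  finally show ?thesis .
qed

end

section \<open>Moments of the running maxima and the averaged recursion\<close>

lemma cube_add_le:
  fixes x y :: real
  assumes "0 \<le> x" "0 \<le> y"
  shows "(x + y) ^ 3 \<le> 4 * (x ^ 3 + y ^ 3)"
proof -
  have "4 * (x ^ 3 + y ^ 3) - (x + y) ^ 3 = 3 * ((x + y) * (x - y)\<^sup>2)"
    by (simp add: power2_eq_square power3_eq_cube algebra_simps)
  also have "\<dots> \<ge> 0" using assms by simp
  finally show ?thesis by simp
qed

lemma power_le_one_add_power:
  fixes a :: real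
  assumes "0 \<le> a" "k \<le> m"
  shows "a ^ k \<le> 1 + a ^ m"
proof (cases "a \<le> 1")
  case True
  then show ?thesis using assms(1) power_le_one[of a k] zero_le_power[of a m] by linarith
next
  case False
  then show ?thesis using power_increasing[OF assms(2), of a] by linarith
qed

context mg1
begin

lemma prob_L_UNIV [simp]: "measure L UNIV = 1"
  using L.prob_space by simp

lemma integrable_moment:
  assumes "k \<le> 3"
  shows "integrable L (\<lambda>a. a ^ k)"
proof (rule Bochner_Integration.integrable_bound)
  show "integrable L (\<lambda>a. 1 + a ^ 3)" using L_int3 by simp
  show "AE a in L. norm (a ^ k) \<le> norm (1 + a ^ 3)"
    using L_nonneg power_le_one_add_power[OF _ assms] by (auto elim!: eventually_mono)
qed simp

lemma integrable_L_id: "integrable L (\<lambda>a. a)" and integrable_L_sq: "integrable L (\<lambda>a. a\<^sup>2)"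
  using integrable_moment[of 1] integrable_moment[of 2] by simp_all

lemma AE_fst_LQ:
  assumes "AE a in L. P a"
  shows "AE p in L \<Otimes>\<^sub>M Q. P (fst p)"
proof (rule AE_distrD[of fst _ L P])
  show "AE a in distr (L \<Otimes>\<^sub>M Q) L fst. P a"
    unfolding prob_space.distr_pair_fst[OF Q.P.prob_space_axioms] by (rule assms)
qed simp

lemma AE_snd_LQ:
  assumes "AE \<omega> in Q. P \<omega>"
  shows "AE p in L \<Otimes>\<^sub>M Q. P (snd p)"
proof (rule AE_distrD[of snd _ Q P])
  have eq: "distr (L \<Otimes>\<^sub>M Q) Q snd = Q"
  proof (rule measure_eqI)
    fix A assume "A \<in> sets (distr (L \<Otimes>\<^sub>M Q) Q snd)"
    then have A: "A \<in> sets Q" by simp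
    then have "snd -` A \<inter> space (L \<Otimes>\<^sub>M Q) = space L \<times> A"
      using sets.sets_into_space[OF A] by (auto simp: space_pair_measure)
    then show "emeasure (distr (L \<Otimes>\<^sub>M Q) Q snd) A = emeasure Q A"
      using A Q.P.emeasure_pair_measure_Times[of "space L" L A] L.emeasure_space_1
      by (simp add: emeasure_distr)
  qed simp
  show "AE \<omega> in distr (L \<Otimes>\<^sub>M Q) Q snd. P \<omega>"
    unfolding eq by (rule assms)
qed simp

lemma AE_LQE:
  "AE p in (L \<Otimes>\<^sub>M Q) \<Otimes>\<^sub>M exp_law lam. 0 \<le> fst (fst p) \<and> 0 \<le> snd p"
proof (rule LQE.AE_pair_measure)
  show "AE x in L \<Otimes>\<^sub>M Q. AE y in exp_law lam. 0 \<le> fst (fst (x, y)) \<and> 0 \<le> snd (x, y)"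
    using AE_fst_LQ[OF L_nonneg] AE_exp_law_nonneg[OF lam] by (auto elim: eventually_mono)
qed measurable

lemma integrable_LQ:
  assumes "integrable L f" "integrable Q g"
  shows "integrable (L \<Otimes>\<^sub>M Q) (\<lambda>p. f (fst p) + g (snd p) :: real)"
  using LQ.product_integrable_mult(1)[OF assms(1), of "\<lambda>_. 1"]
    LQ.product_integrable_mult(1)[OF _ assms(2), of "\<lambda>_. 1"] by simp

text \<open>Induction along Lindley's recursion in law, dropping the subtracted inter-arrival time.
  The estimate worsens with \<open>n\<close>; it only secures finiteness, and uniform bounds come
  later from stability.\<close>

lemma walk_max_integrable_cube: "integrable Q (\<lambda>\<omega>. walk_max n \<omega> ^ 3)"
proof (induction n)
  case 0
  then show ?case by simp
next
  case (Suc n)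
  let ?X = "\<lambda>p. max 0 (fst (fst p) + walk_max n (snd (fst p)) - snd p)"
  let ?P = "(L \<Otimes>\<^sub>M Q) \<Otimes>\<^sub>M exp_law lam"
  have "integrable (L \<Otimes>\<^sub>M Q) (\<lambda>p. 4 * (fst p ^ 3 + walk_max n (snd p) ^ 3))"
    by (rule integrable_mult_right) (rule integrable_LQ[OF L_int3 Suc])
  then have "integrable ?P (\<lambda>p. 4 * (fst (fst p) ^ 3 + walk_max n (snd (fst p)) ^ 3) * 1)"
    using LQE.product_integrable_mult(1)[of "\<lambda>p. 4 * (fst p ^ 3 + walk_max n (snd p) ^ 3)" "\<lambda>_. 1"] by simp
  then have "integrable ?P (\<lambda>p. ?X p ^ 3)"
  proof (rule Bochner_Integration.integrable_bound)
    show "AE p in ?P. norm (?X p ^ 3) \<le> norm (4 * (fst (fst p) ^ 3 + walk_max n (snd (fst p)) ^ 3) * 1)"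
      using AE_LQE
    proof eventually_elim
      case (elim p)
      then have "?X p ^ 3 \<le> (fst (fst p) + walk_max n (snd (fst p))) ^ 3"
        using walk_max_nonneg[of n "snd (fst p)"] by (intro power_mono) auto
      also have "\<dots> \<le> 4 * (fst (fst p) ^ 3 + walk_max n (snd (fst p)) ^ 3)"
        using elim by (intro cube_add_le walk_max_nonneg) auto
      finally show ?case by (simp add: abs_of_nonneg)
    qed
  qed simp
  then have "integrable (distr ?P borel ?X) (\<lambda>x. x ^ 3)"
    by (subst integrable_distr_eq) auto
  then show ?case
    unfolding distr_walk_max_Suc[symmetric] by (subst (asm) integrable_distr_eq) auto
qed

lemma walk_max_integrable_power:
  assumes "k \<le> 3"
  shows "integrable Q (\<lambda>\<omega>. walk_max n \<omega> ^ k)"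
proof (rule Bochner_Integration.integrable_bound)
  show "integrable Q (\<lambda>\<omega>. 1 + walk_max n \<omega> ^ 3)" using walk_max_integrable_cube by simp
  show "AE \<omega> in Q. norm (walk_max n \<omega> ^ k) \<le> norm (1 + walk_max n \<omega> ^ 3)"
    using power_le_one_add_power[OF walk_max_nonneg assms] walk_max_nonneg by (auto intro!: AE_I2)
qed simp

text \<open>In law the next maximum is a reflected exponential step down from
  \<open>fst p + walk_max n (snd p)\<close>; Fubini integrates that step first, where
  \<open>exp_law_integral_Lindley_step\<close> collapses it. The cubic growth bounds match the third
  moments available.\<close>

lemma walk_max_recursion:
  fixes F f :: "real \<Rightarrow> real"
  assumes F: "\<And>x. (F has_real_derivative f x) (at x)"
    and f: "continuous_on UNIV f" "f 0 = 0"
    and growth: "\<And>x. 0 \<le> x \<Longrightarrow> \<bar>F x\<bar> \<le> K * (1 + x ^ 3)" "\<And>x. 0 \<le> x \<Longrightarrow> \<bar>f x\<bar> \<le> K * (1 + x ^ 3)"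
  shows "(\<integral>\<omega>. F (walk_max (Suc n) \<omega>) + f (walk_max (Suc n) \<omega>) / lam \<partial>Q)
    = (\<integral>p. F (fst p + walk_max n (snd p)) \<partial>(L \<Otimes>\<^sub>M Q))"
proof -
  have [measurable]: "F \<in> borel_measurable borel" "f \<in> borel_measurable borel"
    using F by (auto intro!: borel_measurable_continuous_onI f continuous_at_imp_continuous_on DERIV_isCont)
  define g where "g x = F x + f x / lam" for x
  have [measurable]: "g \<in> borel_measurable borel"
    unfolding g_def by measurable
  let ?X = "\<lambda>p. max 0 (fst (fst p) + walk_max n (snd (fst p)) - snd p)"
  let ?P = "(L \<Otimes>\<^sub>M Q) \<Otimes>\<^sub>M exp_law lam"
  have "integrable Q (\<lambda>\<omega>. (K + K / lam) * (1 + walk_max (Suc n) \<omega> ^ 3))"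
    using walk_max_integrable_cube by simp
  then have "integrable Q (\<lambda>\<omega>. g (walk_max (Suc n) \<omega>))"
  proof (rule Bochner_Integration.integrable_bound)
    have "\<bar>g y\<bar> \<le> (K + K / lam) * (1 + y ^ 3)" if "0 \<le> y" for y
    proof -
      have "\<bar>g y\<bar> \<le> \<bar>F y\<bar> + \<bar>f y\<bar> / lam"
        using lam by (simp add: g_def) (metis abs_div_pos abs_triangle_ineq)
      also have "\<dots> \<le> K * (1 + y ^ 3) + K * (1 + y ^ 3) / lam"
        using growth[OF that] lam by (intro add_mono divide_right_mono) auto
      finally show ?thesis by (simp add: algebra_simps add_divide_distrib)
    qed
    then show "AE \<omega> in Q. norm (g (walk_max (Suc n) \<omega>)) \<le> norm ((K + K / lam) * (1 + walk_max (Suc n) \<omega> ^ 3))"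
      using walk_max_nonneg by (auto intro!: AE_I2 order_trans[OF _ abs_ge_self])
  qed simp
  then have "integrable (distr Q borel (walk_max (Suc n))) g"
    by (subst integrable_distr_eq) auto
  then have int: "integrable ?P (\<lambda>p. g (?X p))"
    unfolding distr_walk_max_Suc by (subst (asm) integrable_distr_eq) auto
  have "(\<integral>\<omega>. F (walk_max (Suc n) \<omega>) + f (walk_max (Suc n) \<omega>) / lam \<partial>Q)
    = (\<integral>x. g x \<partial>distr Q borel (walk_max (Suc n)))"
    by (subst integral_distr) (auto simp: g_def)
  also have "\<dots> = (\<integral>p. g (?X p) \<partial>?P)"
    unfolding distr_walk_max_Suc by (subst integral_distr) auto
  also have "\<dots> = (\<integral>q. \<integral>b. g (max 0 (fst q + walk_max n (snd q) - b)) \<partial>exp_law lam \<partial>(L \<Otimes>\<^sub>M Q))"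
    by (subst LQE.integral_fst'[OF int, symmetric]) simp
  also have "\<dots> = (\<integral>p. F (fst p + walk_max n (snd p)) \<partial>(L \<Otimes>\<^sub>M Q))"
  proof (rule integral_cong_AE)
    show "AE q in L \<Otimes>\<^sub>M Q. (\<integral>b. g (max 0 (fst q + walk_max n (snd q) - b)) \<partial>exp_law lam)
        = F (fst q + walk_max n (snd q))"
      using AE_fst_LQ[OF L_nonneg]
    proof eventually_elim
      case (elim q)
      have "(\<integral>b. g (max 0 (fst q + walk_max n (snd q) - b)) \<partial>exp_law lam)
         = (\<integral>b. F (max 0 (fst q + walk_max n (snd q) - b)) + f (max 0 (fst q + walk_max n (snd q) - b)) / lam \<partial>exp_law lam)"
        by (simp add: g_def)
      also have "\<dots> = F (fst q + walk_max n (snd q))"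
        using elim walk_max_nonneg[of n "snd q"]
        by (intro exp_law_integral_Lindley_step[OF lam _ F _ f(2)])
             (auto intro: continuous_on_subset[OF f(1)])
      finally show ?case .
    qed
  qed measurable
  finally show ?thesis .
qed

end

section \<open>The stationary maximum\<close>

locale stable_mg1 = mg1 +
  assumes load_less_1: "lam * (\<integral>a. a \<partial>L) < 1"
begin

lemma walk_max_integrable: "integrable Q (walk_max n)"
  and walk_max_integrable_sq: "integrable Q (\<lambda>\<omega>. (walk_max n \<omega>)\<^sup>2)"
  using walk_max_integrable_power[of 1 n] walk_max_integrable_power[of 2 n] by simp_all

lemma walk_max_moment_mono:
  assumes "k \<le> 3"
  shows "(\<integral>\<omega>. walk_max n \<omega> ^ k \<partial>Q) \<le> (\<integral>\<omega>. walk_max (Suc n) \<omega> ^ k \<partial>Q)"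
  using walk_max_integrable_power[OF assms]
  by (intro integral_mono power_mono walk_max_Suc_le walk_max_nonneg)

text \<open>In the recursion for \<open>x ^ 2\<close> the moments at \<open>Suc n\<close> dominate
  those at \<open>n\<close>. Replacing them cancels the second moments and leaves a linear
  inequality for the mean, solvable because the load is below 1.\<close>

lemma walk_max_mean_bound:
  "(\<integral>\<omega>. walk_max n \<omega> \<partial>Q) \<le> lam * (\<integral>a. a\<^sup>2 \<partial>L) / (2 * (1 - lam * (\<integral>a. a \<partial>L)))"
proof -
  let ?V = "\<lambda>n k. \<integral>\<omega>. walk_max n \<omega> ^ k \<partial>Q"
  have "?V (Suc n) 2 + 2 * ?V (Suc n) 1 / lam
      = (\<integral>\<omega>. (walk_max (Suc n) \<omega>)\<^sup>2 + 2 * walk_max (Suc n) \<omega> / lam \<partial>Q)"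
    using walk_max_integrable[of "Suc n"] walk_max_integrable_sq[of "Suc n"] by simp
  also have "\<dots> = (\<integral>p. (fst p + walk_max n (snd p))\<^sup>2 \<partial>(L \<Otimes>\<^sub>M Q))"
  proof (rule walk_max_recursion[where F = "\<lambda>x. x\<^sup>2" and f = "\<lambda>x. 2 * x" and K = 3])
    show "((\<lambda>x. x\<^sup>2) has_real_derivative 2 * x) (at x)" for x :: real
      by (auto intro!: derivative_eq_intros)
    show "\<bar>x\<^sup>2\<bar> \<le> 3 * (1 + x ^ 3)" "\<bar>2 * x\<bar> \<le> 3 * (1 + x ^ 3)" if "0 \<le> x" for x :: real
      using power_le_one_add_power[OF that, of 2 3] power_le_one_add_power[OF that, of 1 3] that by auto
  qed (auto intro!: continuous_intros)
  \<comment> \<open>Exponents 0 and 1 are written out so that every summand is a product of one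
    power of each coordinate.\<close>
  also have "\<dots> = (\<integral>p. fst p ^ 2 * walk_max n (snd p) ^ 0 + 2 * (fst p ^ 1 * walk_max n (snd p) ^ 1)
       + fst p ^ 0 * walk_max n (snd p) ^ 2 \<partial>(L \<Otimes>\<^sub>M Q))"
    by (simp add: power2_sum algebra_simps)
  also have "\<dots> = (\<integral>a. a\<^sup>2 \<partial>L) + 2 * ((\<integral>a. a \<partial>L) * ?V n 1) + ?V n 2"
    using LQ.product_integrable_mult[OF integrable_moment walk_max_integrable_power, of 2 0 n]
      LQ.product_integrable_mult[OF integrable_moment walk_max_integrable_power, of 1 1 n]
      LQ.product_integrable_mult[OF integrable_moment walk_max_integrable_power, of 0 2 n]
    by (simp add: Q.P.prob_space)
  finally have "2 * ?V n 1 / lam \<le> (\<integral>a. a\<^sup>2 \<partial>L) + 2 * ((\<integral>a. a \<partial>L) * ?V n 1)"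
    using walk_max_moment_mono[of 2 n] divide_right_mono[OF walk_max_moment_mono[of 1 n], of lam] lam
    by simp
  then show ?thesis
    using lam load_less_1 by (simp add: field_simps)
qed

text \<open>The same cancellation one degree higher: third moments of the maxima need only be finite
  and increasing in \<open>n\<close>, while the mixed term is controlled by the uniform bound on the
  mean.\<close>

lemma walk_max_second_moment_bound:
  obtains B where "\<And>n. (\<integral>\<omega>. (walk_max n \<omega>)\<^sup>2 \<partial>Q) \<le> B"
proof
  fix n
  define B where "B = lam * (\<integral>a. a\<^sup>2 \<partial>L) / (2 * (1 - lam * (\<integral>a. a \<partial>L)))"
  let ?V = "\<lambda>n k. \<integral>\<omega>. walk_max n \<omega> ^ k \<partial>Q"
  have "?V (Suc n) 3 + 3 * ?V (Suc n) 2 / lam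
      = (\<integral>\<omega>. walk_max (Suc n) \<omega> ^ 3 + 3 * (walk_max (Suc n) \<omega>)\<^sup>2 / lam \<partial>Q)"
    using walk_max_integrable_sq[of "Suc n"] walk_max_integrable_cube[of "Suc n"] by simp
  also have "\<dots> = (\<integral>p. (fst p + walk_max n (snd p)) ^ 3 \<partial>(L \<Otimes>\<^sub>M Q))"
  proof (rule walk_max_recursion[where F = "\<lambda>x. x ^ 3" and f = "\<lambda>x. 3 * x\<^sup>2" and K = 3])
    show "((\<lambda>x. x ^ 3) has_real_derivative 3 * x\<^sup>2) (at x)" for x :: real
      by (auto intro!: derivative_eq_intros)
    show "\<bar>x ^ 3\<bar> \<le> 3 * (1 + x ^ 3)" "\<bar>3 * x\<^sup>2\<bar> \<le> 3 * (1 + x ^ 3)" if "0 \<le> x" for x :: real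
      using power_le_one_add_power[OF that, of 2 3] that by (auto simp: abs_mult)
  qed (auto intro!: continuous_intros)
  also have "\<dots> = (\<integral>p. fst p ^ 3 * walk_max n (snd p) ^ 0 + 3 * (fst p ^ 2 * walk_max n (snd p) ^ 1)
       + 3 * (fst p ^ 1 * walk_max n (snd p) ^ 2) + fst p ^ 0 * walk_max n (snd p) ^ 3 \<partial>(L \<Otimes>\<^sub>M Q))"
    by (simp add: power2_eq_square power3_eq_cube algebra_simps)
  also have "\<dots> = (\<integral>a. a ^ 3 \<partial>L) + 3 * ((\<integral>a. a\<^sup>2 \<partial>L) * ?V n 1) + 3 * ((\<integral>a. a \<partial>L) * ?V n 2) + ?V n 3"
    using LQ.product_integrable_mult[OF integrable_moment walk_max_integrable_power, of 3 0 n]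
      LQ.product_integrable_mult[OF integrable_moment walk_max_integrable_power, of 2 1 n]
      LQ.product_integrable_mult[OF integrable_moment walk_max_integrable_power, of 1 2 n]
      LQ.product_integrable_mult[OF integrable_moment walk_max_integrable_power, of 0 3 n]
    by (simp add: Q.P.prob_space)
  finally have "3 * ?V n 2 / lam \<le> (\<integral>a. a ^ 3 \<partial>L) + 3 * ((\<integral>a. a\<^sup>2 \<partial>L) * ?V n 1) + 3 * ((\<integral>a. a \<partial>L) * ?V n 2)"
    using walk_max_moment_mono[of 3 n] divide_right_mono[OF walk_max_moment_mono[of 2 n], of lam] lam
    by simp
  moreover have "(\<integral>a. a\<^sup>2 \<partial>L) * ?V n 1 \<le> (\<integral>a. a\<^sup>2 \<partial>L) * B"
    using walk_max_mean_bound[of n] by (intro mult_left_mono) (auto simp: B_def)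
  ultimately have "3 * ?V n 2 / lam \<le> (\<integral>a. a ^ 3 \<partial>L) + 3 * ((\<integral>a. a\<^sup>2 \<partial>L) * B) + 3 * ((\<integral>a. a \<partial>L) * ?V n 2)"
    by simp
  then show "?V n 2 \<le> lam * ((\<integral>a. a ^ 3 \<partial>L) + 3 * ((\<integral>a. a\<^sup>2 \<partial>L) *
      (lam * (\<integral>a. a\<^sup>2 \<partial>L) / (2 * (1 - lam * (\<integral>a. a \<partial>L)))))) / (3 * (1 - lam * (\<integral>a. a \<partial>L)))"
    unfolding B_def[symmetric]
    using lam load_less_1 by (simp add: field_simps)
qed

text \<open>By monotone convergence the supremum of the running maxima inherits the uniform bound on
  their means, hence is almost surely finite. Stability enters through that bound instead of a drift
  argument.\<close>

lemma AE_walk_max_bdd: "AE \<omega> in Q. bdd_above (range (\<lambda>n. walk_max n \<omega>))"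
proof -
  let ?B = "lam * (\<integral>a. a\<^sup>2 \<partial>L) / (2 * (1 - lam * (\<integral>a. a \<partial>L)))"
  have "(\<integral>\<^sup>+\<omega>. (SUP n. ennreal (walk_max n \<omega>)) \<partial>Q) = (SUP n. \<integral>\<^sup>+\<omega>. ennreal (walk_max n \<omega>) \<partial>Q)"
    using incseq_walk_max
    by (intro nn_integral_monotone_convergence_SUP) (auto simp: incseq_def le_fun_def ennreal_leI)
  also have "\<dots> \<le> ennreal ?B"
    using walk_max_mean_bound walk_max_integrable
    by (intro SUP_least) (subst nn_integral_eq_integral, auto simp: walk_max_nonneg ennreal_leI)
  finally have "(\<integral>\<^sup>+\<omega>. (SUP n. ennreal (walk_max n \<omega>)) \<partial>Q) \<noteq> \<infinity>"
    by (auto simp: top_unique)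
  then have "AE \<omega> in Q. (SUP n. ennreal (walk_max n \<omega>)) \<noteq> \<infinity>"
    by (intro nn_integral_PInf_AE) auto
  then show ?thesis
  proof eventually_elim
    case (elim \<omega>)
    then obtain r where r: "(SUP n. ennreal (walk_max n \<omega>)) = ennreal r" "0 \<le> r"
      by (cases "SUP n. ennreal (walk_max n \<omega>)") auto
    have "walk_max n \<omega> \<le> r" for n
      using SUP_upper[of n UNIV "\<lambda>n. ennreal (walk_max n \<omega>)"] r by simp
    then show ?case by (auto simp: bdd_above_def)
  qed
qed

lemma AE_walk_sup:
  "AE \<omega> in Q. (\<lambda>n. walk_max n \<omega>) \<longlonglongrightarrow> walk_sup \<omega> \<and> (\<forall>n. walk_max n \<omega> \<le> walk_sup \<omega>)"
  using AE_walk_max_bdd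
  by eventually_elim (auto intro: walk_max_LIMSEQ incseq_le incseq_walk_max)

lemma AE_walk_sup_nonneg: "AE \<omega> in Q. 0 \<le> walk_sup \<omega>"
  using AE_walk_sup by eventually_elim (metis walk_max_0)

lemma walk_sup_integrable_sq: "integrable Q (\<lambda>\<omega>. (walk_sup \<omega>)\<^sup>2)"
proof -
  obtain B where B: "\<And>n. (\<integral>\<omega>. (walk_max n \<omega>)\<^sup>2 \<partial>Q) \<le> B"
    using walk_max_second_moment_bound by blast
  have "incseq (\<lambda>n. \<integral>\<omega>. (walk_max n \<omega>)\<^sup>2 \<partial>Q)"
    using walk_max_moment_mono[of 2] by (intro incseq_SucI) auto
  then obtain l where "(\<lambda>n. \<integral>\<omega>. (walk_max n \<omega>)\<^sup>2 \<partial>Q) \<longlonglongrightarrow> l"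
    using incseq_convergent[of _ B] B by metis
  then show ?thesis
  proof (rule integrable_monotone_convergence[rotated 3])
    show "AE \<omega> in Q. mono (\<lambda>n. (walk_max n \<omega>)\<^sup>2)"
      using incseq_walk_max by (intro AE_I2) (auto simp: mono_def walk_max_nonneg intro!: power_mono)
    show "AE \<omega> in Q. (\<lambda>n. (walk_max n \<omega>)\<^sup>2) \<longlonglongrightarrow> (walk_sup \<omega>)\<^sup>2"
      using AE_walk_sup by eventually_elim (auto intro: tendsto_power)
  qed (auto intro: walk_max_integrable_sq)
qed

lemma walk_sup_integrable: "integrable Q walk_sup"
proof (rule Bochner_Integration.integrable_bound)
  show "integrable Q (\<lambda>\<omega>. 1 + (walk_sup \<omega>)\<^sup>2)" using walk_sup_integrable_sq by simp
  show "AE \<omega> in Q. norm (walk_sup \<omega>) \<le> norm (1 + (walk_sup \<omega>)\<^sup>2)"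
    using AE_walk_sup_nonneg
  proof eventually_elim
    case (elim \<omega>)
    then show ?case using power_le_one_add_power[of "walk_sup \<omega>" 1 2] by simp
  qed
qed simp

text \<open>Dominated convergence in the recursion for running maxima. Quadratic growth is what the
  square integrability of \<open>walk_sup\<close> can dominate, because the maxima stay below it and
  the bound is increasing.\<close>

lemma walk_sup_recursion:
  fixes F f :: "real \<Rightarrow> real"
  assumes F: "\<And>x. (F has_real_derivative f x) (at x)"
    and f: "continuous_on UNIV f" "f 0 = 0"
    and "\<forall>x\<ge>0. \<bar>F x\<bar> \<le> K * (1 + x\<^sup>2)" "\<forall>x\<ge>0. \<bar>f x\<bar> \<le> K * (1 + x\<^sup>2)"
  shows "integrable Q (\<lambda>\<omega>. F (walk_sup \<omega>))" "integrable Q (\<lambda>\<omega>. f (walk_sup \<omega>))"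
    "integrable (L \<Otimes>\<^sub>M Q) (\<lambda>p. F (fst p + walk_sup (snd p)))"
    "(\<integral>\<omega>. F (walk_sup \<omega>) \<partial>Q) + (\<integral>\<omega>. f (walk_sup \<omega>) \<partial>Q) / lam
      = (\<integral>p. F (fst p + walk_sup (snd p)) \<partial>(L \<Otimes>\<^sub>M Q))"
proof -
  note growth = assms(4)[rule_format] assms(5)[rule_format]
  have K: "0 \<le> K" using growth(1)[of 0] by simp
  have contF: "continuous_on UNIV F"
    using F by (auto intro!: continuous_at_imp_continuous_on DERIV_isCont)
  have [measurable]: "F \<in> borel_measurable borel" "f \<in> borel_measurable borel"
    by (auto intro!: borel_measurable_continuous_onI f contF)
  have wQ: "integrable Q (\<lambda>\<omega>. K * (1 + (walk_sup \<omega>)\<^sup>2))"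
    using walk_sup_integrable_sq by simp
  have mono: "K * (1 + x\<^sup>2) \<le> K * (1 + y\<^sup>2)" if "0 \<le> x" "x \<le> y" for x y :: real
    using K that by (intro mult_left_mono add_left_mono power_mono) auto
  have wP: "integrable (L \<Otimes>\<^sub>M Q) (\<lambda>p. K * (1 + (fst p + walk_sup (snd p))\<^sup>2))"
  proof -
    have "integrable (L \<Otimes>\<^sub>M Q) (\<lambda>p. fst p ^ 2 + (walk_sup (snd p))\<^sup>2)"
      by (rule integrable_LQ[OF integrable_L_sq walk_sup_integrable_sq])
    moreover have "integrable (L \<Otimes>\<^sub>M Q) (\<lambda>p. fst p * walk_sup (snd p))"
      by (rule LQ.product_integrable_mult(1)[OF integrable_L_id walk_sup_integrable])
    ultimately have "integrable (L \<Otimes>\<^sub>M Q) (\<lambda>p. K * (1 + ((fst p ^ 2 + (walk_sup (snd p))\<^sup>2) + 2 * (fst p * walk_sup (snd p)))))"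
      by simp
    then show ?thesis by (simp add: power2_sum algebra_simps)
  qed
  have AEP: "AE p in L \<Otimes>\<^sub>M Q. 0 \<le> fst p \<and> (\<lambda>n. walk_max n (snd p)) \<longlonglongrightarrow> walk_sup (snd p)
      \<and> (\<forall>n. walk_max n (snd p) \<le> walk_sup (snd p))"
    using AE_fst_LQ[OF L_nonneg] AE_snd_LQ[OF AE_walk_sup] by eventually_elim auto
  have b: "AE \<omega> in Q. norm (G (walk_max n \<omega>)) \<le> K * (1 + (walk_sup \<omega>)\<^sup>2)"
    if G: "\<And>x. 0 \<le> x \<Longrightarrow> \<bar>G x\<bar> \<le> K * (1 + x\<^sup>2)" for n and G :: "real \<Rightarrow> real"
    using AE_walk_sup
  proof eventually_elim
    case (elim \<omega>)
    then show ?case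
      using order_trans[OF G mono] walk_max_nonneg[of n \<omega>] by simp
  qed
  note bF = b[OF growth(1)] and bf = b[OF growth(2)]
  have lF: "AE \<omega> in Q. (\<lambda>n. F (walk_max n \<omega>)) \<longlonglongrightarrow> F (walk_sup \<omega>)"
    and lf: "AE \<omega> in Q. (\<lambda>n. f (walk_max n \<omega>)) \<longlonglongrightarrow> f (walk_sup \<omega>)"
    using AE_walk_sup contF f(1)
    by (auto elim!: eventually_mono intro: continuous_on_tendsto_compose)
  have bP: "AE p in L \<Otimes>\<^sub>M Q. norm (F (fst p + walk_max n (snd p))) \<le> K * (1 + (fst p + walk_sup (snd p))\<^sup>2)" for n
    using AEP
  proof eventually_elim
    case (elim p)
    have "norm (F (fst p + walk_max n (snd p))) \<le> K * (1 + (fst p + walk_max n (snd p))\<^sup>2)"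
      using growth(1)[of "fst p + walk_max n (snd p)"] elim walk_max_nonneg[of n "snd p"] by simp
    also have "\<dots> \<le> K * (1 + (fst p + walk_sup (snd p))\<^sup>2)"
      using elim walk_max_nonneg[of n "snd p"] by (intro mono) auto
    finally show ?case .
  qed
  have lP: "AE p in L \<Otimes>\<^sub>M Q. (\<lambda>n. F (fst p + walk_max n (snd p))) \<longlonglongrightarrow> F (fst p + walk_sup (snd p))"
    using AEP
  proof eventually_elim
    case (elim p)
    then have "(\<lambda>n. fst p + walk_max n (snd p)) \<longlonglongrightarrow> fst p + walk_sup (snd p)"
      by (intro tendsto_add tendsto_const) auto
    then show ?case by (rule continuous_on_tendsto_compose[OF contF]) auto
  qed
  show iF: "integrable Q (\<lambda>\<omega>. F (walk_sup \<omega>))"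
    by (rule integrable_dominated_convergence[OF _ _ wQ lF bF]) measurable
  show "integrable Q (\<lambda>\<omega>. f (walk_sup \<omega>))"
    by (rule integrable_dominated_convergence[OF _ _ wQ lf bf]) measurable
  show "integrable (L \<Otimes>\<^sub>M Q) (\<lambda>p. F (fst p + walk_sup (snd p)))"
    by (rule integrable_dominated_convergence[OF _ _ wP lP bP]) measurable
  have "(\<lambda>n. \<integral>\<omega>. F (walk_max n \<omega>) \<partial>Q) \<longlonglongrightarrow> (\<integral>\<omega>. F (walk_sup \<omega>) \<partial>Q)"
    by (rule integral_dominated_convergence[OF _ _ wQ lF bF]) measurable
  moreover have "(\<lambda>n. \<integral>\<omega>. f (walk_max n \<omega>) \<partial>Q) \<longlonglongrightarrow> (\<integral>\<omega>. f (walk_sup \<omega>) \<partial>Q)"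
    by (rule integral_dominated_convergence[OF _ _ wQ lf bf]) measurable
  \<comment> \<open>The recursion relates \<open>Suc n\<close> on the left to \<open>n\<close> on
    the right; the shift of index does not change the limit.\<close>
  ultimately have lim: "(\<lambda>n. (\<integral>\<omega>. F (walk_max (Suc n) \<omega>) \<partial>Q) + (\<integral>\<omega>. f (walk_max (Suc n) \<omega>) \<partial>Q) / lam)
      \<longlonglongrightarrow> (\<integral>\<omega>. F (walk_sup \<omega>) \<partial>Q) + (\<integral>\<omega>. f (walk_sup \<omega>) \<partial>Q) / lam"
    using lam by (intro tendsto_intros LIMSEQ_Suc) auto
  have limP: "(\<lambda>n. \<integral>p. F (fst p + walk_max n (snd p)) \<partial>(L \<Otimes>\<^sub>M Q)) \<longlonglongrightarrow> (\<integral>p. F (fst p + walk_sup (snd p)) \<partial>(L \<Otimes>\<^sub>M Q))"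
    by (rule integral_dominated_convergence[OF _ _ wP lP bP]) measurable
  \<comment> \<open>Since \<open>1 + x ^ 2\<close> is at most \<open>2 * (1 + x ^ 3)\<close> on the
    half-line, doubling \<open>K\<close> meets the cubic growth condition of the finite
    recursion.\<close>
  have growth3: "\<bar>G x\<bar> \<le> (2 * K) * (1 + x ^ 3)" if "\<bar>G x\<bar> \<le> K * (1 + x\<^sup>2)" "0 \<le> x" for G :: "real \<Rightarrow> real" and x
  proof -
    have *: "1 + a \<le> 2 * (1 + b)" if "a \<le> 1 + b" "0 \<le> b" for a b :: real
      using that by simp
    have "1 + x\<^sup>2 \<le> 2 * (1 + x ^ 3)"
      by (rule *[OF power_le_one_add_power[OF that(2)] zero_le_power[OF that(2)]]) simp
    then have "K * (1 + x\<^sup>2) \<le> K * (2 * (1 + x ^ 3))" using K by (rule mult_left_mono)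
    from order_trans[OF that(1) this] show ?thesis by (simp only: mult_ac)
  qed
  have "(\<integral>\<omega>. F (walk_max (Suc n) \<omega>) \<partial>Q) + (\<integral>\<omega>. f (walk_max (Suc n) \<omega>) \<partial>Q) / lam
      = (\<integral>p. F (fst p + walk_max n (snd p)) \<partial>(L \<Otimes>\<^sub>M Q))" for n
  proof -
    have "integrable Q (\<lambda>\<omega>. F (walk_max (Suc n) \<omega>))"
      by (rule Bochner_Integration.integrable_bound[OF wQ _ eventually_mono[OF bF[of "Suc n"]]]) auto
    moreover have "integrable Q (\<lambda>\<omega>. f (walk_max (Suc n) \<omega>))"
      by (rule Bochner_Integration.integrable_bound[OF wQ _ eventually_mono[OF bf[of "Suc n"]]]) auto
    ultimately have "(\<integral>\<omega>. F (walk_max (Suc n) \<omega>) \<partial>Q) + (\<integral>\<omega>. f (walk_max (Suc n) \<omega>) \<partial>Q) / lam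
       = (\<integral>\<omega>. F (walk_max (Suc n) \<omega>) + f (walk_max (Suc n) \<omega>) / lam \<partial>Q)"
      by simp
    also have "\<dots> = (\<integral>p. F (fst p + walk_max n (snd p)) \<partial>(L \<Otimes>\<^sub>M Q))"
      by (rule walk_max_recursion[OF F f, where K="2 * K"]) (auto intro!: growth3 growth)
    finally show ?thesis .
  qed
  with lim limP show "(\<integral>\<omega>. F (walk_sup \<omega>) \<partial>Q) + (\<integral>\<omega>. f (walk_sup \<omega>) \<partial>Q) / lam
      = (\<integral>p. F (fst p + walk_sup (snd p)) \<partial>(L \<Otimes>\<^sub>M Q))"
    using LIMSEQ_unique by fastforce
qed

text \<open>The Pollaczek-Khinchine mean formula: for \<open>x ^ 2\<close> the finite second moment
  cancels, and the remaining equation is linear in the mean.\<close>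

lemma walk_sup_mean:
  "(\<integral>\<omega>. walk_sup \<omega> \<partial>Q) = lam * (\<integral>a. a\<^sup>2 \<partial>L) / (2 * (1 - lam * (\<integral>a. a \<partial>L)))"
proof -
  have "(\<integral>\<omega>. (walk_sup \<omega>)\<^sup>2 \<partial>Q) + (\<integral>\<omega>. 2 * walk_sup \<omega> \<partial>Q) / lam = (\<integral>p. (fst p + walk_sup (snd p))\<^sup>2 \<partial>(L \<Otimes>\<^sub>M Q))"
  proof (rule walk_sup_recursion(4)[where F = "\<lambda>x. x\<^sup>2" and f = "\<lambda>x. 2 * x" and K = 2])
    show "((\<lambda>x. x\<^sup>2) has_real_derivative 2 * x) (at x)" for x :: real
      by (auto intro!: derivative_eq_intros)
    show "\<forall>x\<ge>0::real. \<bar>x\<^sup>2\<bar> \<le> 2 * (1 + x\<^sup>2)" "\<forall>x\<ge>0::real. \<bar>2 * x\<bar> \<le> 2 * (1 + x\<^sup>2)"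
      using power_le_one_add_power[where k = 1 and m = 2] by fastforce+
  qed (auto intro!: continuous_intros)
  also have "\<dots> = (\<integral>p. fst p ^ 2 * 1 + 2 * (fst p * walk_sup (snd p)) + 1 * (walk_sup (snd p))\<^sup>2 \<partial>(L \<Otimes>\<^sub>M Q))"
    by (simp add: power2_sum algebra_simps)
  also have "\<dots> = (\<integral>a. a\<^sup>2 \<partial>L) + 2 * ((\<integral>a. a \<partial>L) * (\<integral>\<omega>. walk_sup \<omega> \<partial>Q)) + (\<integral>\<omega>. (walk_sup \<omega>)\<^sup>2 \<partial>Q)"
    using LQ.product_integrable_mult[OF integrable_L_sq, of "\<lambda>_. 1"]
      LQ.product_integrable_mult[OF integrable_L_id walk_sup_integrable]
      LQ.product_integrable_mult[OF _ walk_sup_integrable_sq, of "\<lambda>_. 1"]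
    by (simp add: Q.P.prob_space)
  finally show ?thesis
    using lam load_less_1 walk_sup_integrable by (simp add: field_simps)
qed

end

section \<open>Wasserstein bounds\<close>

text \<open>Composing with \<open>max 0\<close> discards the arbitrary values of a test function on
  the negative reals, giving a measurable function that agrees with it where the law has its
  mass.\<close>

lemma set_integral_nonneg_half_line:
  fixes h :: "real \<Rightarrow> real"
  assumes [measurable_cong]: "sets \<mu> = sets borel" and "AE x in \<mu>. 0 \<le> x"
    and [measurable]: "(\<lambda>x. h (max 0 x)) \<in> borel_measurable borel"
  shows "(LINT x:{0..}|\<mu>. h x) = (\<integral>x. h (max 0 x) \<partial>\<mu>)"
proof -
  have "(LINT x:{0..}|\<mu>. h x) = (\<integral>x. indicator {0..} x * h (max 0 x) \<partial>\<mu>)"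
    unfolding set_lebesgue_integral_def
    by (rule Bochner_Integration.integral_cong) (auto simp: indicator_def)
  also have "\<dots> = (\<integral>x. h (max 0 x) \<partial>\<mu>)"
    by (rule integral_cong_AE) (use assms(2) in \<open>auto elim!: eventually_mono\<close>)
  finally show ?thesis .
qed

lemma lipschitz_on_max_0:
  fixes h :: "real \<Rightarrow> real"
  assumes "L-lipschitz_on {0..} h"
  shows "L-lipschitz_on UNIV (\<lambda>x. h (max 0 x))"
proof (rule lipschitz_onI)
  fix x y :: real
  have "dist (h (max 0 x)) (h (max 0 y)) \<le> L * dist (max 0 x) (max 0 y)"
    by (rule lipschitz_onD[OF assms]) auto
  also have "\<dots> \<le> L * dist x y"
    using lipschitz_on_nonneg[OF assms] by (intro mult_left_mono) (auto simp: dist_real_def)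
  finally show "dist (h (max 0 x)) (h (max 0 y)) \<le> L * dist x y" .
qed (rule lipschitz_on_nonneg[OF assms])

text \<open>Projection onto the half-line is nonexpansive, so every test function extends to the
  real line with the same Lipschitz constant; bounding the globally Lipschitz ones is
  enough.\<close>

lemma wasserstein_le:
  assumes "sets \<mu> = sets borel" "AE x in \<mu>. 0 \<le> x" "sets \<nu> = sets borel" "AE x in \<nu>. 0 \<le> x"
    and "\<And>h. 1-lipschitz_on UNIV h \<Longrightarrow> \<bar>(\<integral>x. h x \<partial>\<mu>) - (\<integral>x. h x \<partial>\<nu>)\<bar> \<le> B"
  shows "wasserstein \<mu> \<nu> \<le> ereal B"
  unfolding wasserstein_def
proof (rule SUP_least, clarify)
  fix h :: "real \<Rightarrow> real" assume "1-lipschitz_on {0..} h"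
  then have "1-lipschitz_on UNIV (\<lambda>x. h (max 0 x))" by (rule lipschitz_on_max_0)
  with assms(5)[OF this] show "ereal \<bar>(LINT x:{0..}|\<mu>. h x) - (LINT x:{0..}|\<nu>. h x)\<bar> \<le> ereal B"
    using assms(1-4) by (simp add: set_integral_nonneg_half_line lipschitz_borel_measurable)
qed

lemma wasserstein_ge:
  fixes h :: "real \<Rightarrow> real"
  assumes "sets \<mu> = sets borel" "AE x in \<mu>. 0 \<le> x" "sets \<nu> = sets borel" "AE x in \<nu>. 0 \<le> x"
    and h: "1-lipschitz_on {0..} h"
  shows "ereal \<bar>(\<integral>x. h (max 0 x) \<partial>\<mu>) - (\<integral>x. h (max 0 x) \<partial>\<nu>)\<bar> \<le> wasserstein \<mu> \<nu>"
proof -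
  have "(\<lambda>x. h (max 0 x)) \<in> borel_measurable borel"
    using lipschitz_borel_measurable[OF lipschitz_on_max_0[OF h]] .
  then have "ereal \<bar>(\<integral>x. h (max 0 x) \<partial>\<mu>) - (\<integral>x. h (max 0 x) \<partial>\<nu>)\<bar>
      = ereal \<bar>(LINT x:{0..}|\<mu>. h x) - (LINT x:{0..}|\<nu>. h x)\<bar>"
    using assms(1-4) by (simp add: set_integral_nonneg_half_line)
  also have "\<dots> \<le> wasserstein \<mu> \<nu>"
    unfolding wasserstein_def by (rule SUP_upper) (use h in simp)
  finally show ?thesis .
qed

text \<open>The Taylor remainder of third order is evaluated at a point not below
  \<open>- x\<close>. Keeping a definite cubic gain, and not just the quadratic upper bound, is what
  makes the optimality constant positive.\<close>

lemma exp_minus_le_cubic: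
  fixes x :: real
  assumes "0 \<le> x"
  shows "exp (- x) \<le> 1 - x + x\<^sup>2 / 2 - x ^ 3 * exp (- x) / 6"
proof -
  obtain t where t: "\<bar>t\<bar> \<le> \<bar>- x\<bar>"
    "exp (- x) = (\<Sum>m<3. (- x) ^ m / fact m) + exp t / fact 3 * (- x) ^ 3"
    using Maclaurin_exp_le[of "- x" 3] by blast
  have "x ^ 3 * exp (- x) \<le> x ^ 3 * exp t"
    using t(1) assms by (intro mult_left_mono) auto
  moreover have "exp (- x) = 1 - x + x\<^sup>2 / 2 - x ^ 3 * exp t / 6"
    by (subst t(2)) (simp add: numeral_eq_Suc)
  ultimately show ?thesis by linarith
qed

section \<open>Removing the index offsets of \<open>walk\<close>\<close>

lemma walk_eq_partial_walk:
  "walk \<omega> i = partial_walk (\<lambda>j. fst \<omega> (j + 1), \<lambda>j. snd \<omega> (j + 2)) i"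
  unfolding walk_def partial_walk_def
  by (rule sum.reindex_bij_witness[where i=Suc and j="\<lambda>j. j - 1"]) auto

lemma waiting_time_eq_walk_sup:
  "waiting_time \<omega> = walk_sup (\<lambda>j. fst \<omega> (j + 1), \<lambda>j. snd \<omega> (j + 2))"
  by (simp add: waiting_time_def walk_sup_def walk_eq_partial_walk[abs_def])

context mg1
begin

lemma measurable_shift [measurable]:
  "(\<lambda>\<omega>. (\<lambda>j. fst \<omega> (j + 1), \<lambda>j. snd \<omega> (j + 2))) \<in> Q \<rightarrow>\<^sub>M Q"
  by (intro measurable_Pair measurable_abs_UNIV) measurable

text \<open>Dropping initial coordinates is a reindexing along an injective map, which preserves an
  i.i.d. product. The offsets 1 and 2 are the first service and inter-arrival indices that
  \<open>walk\<close> uses.\<close>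

lemma Q_shift:
  "distr Q Q (\<lambda>\<omega>. (\<lambda>j. fst \<omega> (j + 1), \<lambda>j. snd \<omega> (j + 2))) = Q"
proof -
  have s: "distr services services (\<lambda>s j. s (j + 1)) = services"
    using distr_PiM_reindex[of UNIV "\<lambda>_. L" Suc UNIV] by (simp add: prob_L comp_def restrict_UNIV)
  have a: "distr arrivals arrivals (\<lambda>s j. s (j + 2)) = arrivals"
    using distr_PiM_reindex[of UNIV "\<lambda>_. exp_law lam" "\<lambda>j. j + 2 :: nat" UNIV]
    by (simp add: prob_space_exp_law lam comp_def restrict_UNIV inj_def)
  have "Q = distr services services (\<lambda>s j. s (j + 1)) \<Otimes>\<^sub>M distr arrivals arrivals (\<lambda>s j. s (j + 2))"
    unfolding s a ..
  also have "\<dots> = distr Q Q (\<lambda>(s, x). (\<lambda>j. s (j + 1), \<lambda>j. x (j + 2)))"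
    by (rule pair_measure_distr)
       (unfold a, auto intro!: measurable_abs_UNIV simp: Es.P.sigma_finite_measure_axioms)
  finally show ?thesis by (simp add: case_prod_beta')
qed

lemma law_waiting_time: "law Q (\<lambda>\<omega>. c * waiting_time \<omega>) = law Q (\<lambda>\<omega>. c * walk_sup \<omega>)"
proof -
  have "law Q (\<lambda>\<omega>. c * walk_sup \<omega>) =
      law (distr Q Q (\<lambda>\<omega>. (\<lambda>j. fst \<omega> (j + 1), \<lambda>j. snd \<omega> (j + 2)))) (\<lambda>\<omega>. c * walk_sup \<omega>)"
    by (simp only: Q_shift)
  also have "\<dots> = law Q (\<lambda>\<omega>. c * waiting_time \<omega>)"
    by (subst distr_distr[OF _ measurable_shift]) (simp_all add: comp_def waiting_time_eq_walk_sup)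
  finally show ?thesis ..
qed

end

section \<open>Stein estimate and Laplace transform of the maximum\<close>

context stable_mg1
begin

text \<open>Here \<open>\<alpha>\<close> is the mean from \<open>walk_sup_mean\<close>. The
  recursion for an antiderivative of the rescaled Stein solution is compared with its second-order
  expansion in the service time; this choice of \<open>\<alpha>\<close> cancels the mean of
  \<open>f\<close> and leaves a multiple of the distance to be bounded.\<close>

lemma stein_bound:
  fixes h :: "real \<Rightarrow> real"
  assumes h: "1-lipschitz_on UNIV h" and m2: "0 < (\<integral>a. a\<^sup>2 \<partial>L)"
  defines "\<rho> \<equiv> lam * (\<integral>a. a \<partial>L)"
  defines "\<alpha> \<equiv> lam * (\<integral>a. a\<^sup>2 \<partial>L) / (2 * (1 - \<rho>))"
  shows "\<bar>(\<integral>\<omega>. h (walk_sup \<omega> / \<alpha>) \<partial>Q) - (\<integral>z. h z \<partial>exp_law 1)\<bar>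
    \<le> 4 * (\<integral>a. a ^ 3 \<partial>L) / (3 * lam * (\<integral>a. a\<^sup>2 \<partial>L)\<^sup>2) * (1 - \<rho>)"
proof -
  have \<rho>: "\<rho> < 1" using load_less_1 by (simp add: \<rho>_def)
  have \<alpha>: "0 < \<alpha>" using m2 lam \<rho> by (simp add: \<alpha>_def)
  define \<mu> where "\<mu> = (\<integral>z. h z \<partial>exp_law 1)"
  define f where "f x = stein_solution h (x / \<alpha>)" for x
  define f' where "f' x = (stein_solution h (x / \<alpha>) + h (x / \<alpha>) - \<mu>) / \<alpha>" for x
  have f_deriv: "(f has_real_derivative f' x) (at x)" for x
  proof -
    have "((\<lambda>x. stein_solution h (x / \<alpha>)) has_real_derivative
        (stein_solution h (x / \<alpha>) + h (x / \<alpha>) - \<mu>) * (1 / \<alpha>)) (at x)"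
      unfolding \<mu>_def
      by (rule DERIV_chain2[where g="\<lambda>x. x / \<alpha>", OF stein_solution_deriv[OF h]])
         (use \<alpha> in \<open>auto intro!: derivative_eq_intros\<close>)
    then show ?thesis by (simp add: f_def[abs_def] f'_def)
  qed
  then have f_cont: "isCont f x" for x by (rule DERIV_isCont)
  have f_bound: "\<bar>f x\<bar> \<le> \<bar>x\<bar> / \<alpha>" for x
    using lipschitz_real_bound[OF stein_solution_lipschitz[OF h], of "x / \<alpha>" 0] \<alpha> by (simp add: f_def)
  \<comment> \<open>Two functions that are 1-Lipschitz in \<open>x / \<alpha>\<close> are added and
    divided by \<open>\<alpha>\<close>, whence the constant
    \<open>2 / \<alpha>\<^sup>2\<close>.\<close>
  have lip': "\<bar>f' y - f' x\<bar> \<le> 2 / \<alpha>\<^sup>2 * (y - x)" if "0 \<le> x" "x \<le> y" for x y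
  proof -
    have "\<bar>stein_solution h (y / \<alpha>) - stein_solution h (x / \<alpha>)\<bar> \<le> (y - x) / \<alpha>"
      "\<bar>h (y / \<alpha>) - h (x / \<alpha>)\<bar> \<le> (y - x) / \<alpha>"
      using lipschitz_real_bound[OF stein_solution_lipschitz[OF h], of "y / \<alpha>" "x / \<alpha>"]
        lipschitz_real_bound[OF h, of "y / \<alpha>" "x / \<alpha>"] \<alpha> that
      by (simp_all flip: diff_divide_distrib)
    then have *: "\<bar>(stein_solution h (y / \<alpha>) - stein_solution h (x / \<alpha>)) + (h (y / \<alpha>) - h (x / \<alpha>))\<bar> / \<alpha>
        \<le> ((y - x) / \<alpha> + (y - x) / \<alpha>) / \<alpha>"
      using \<alpha> by (intro divide_right_mono order_trans[OF abs_triangle_ineq] add_mono) auto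
    have "f' y - f' x = ((stein_solution h (y / \<alpha>) - stein_solution h (x / \<alpha>)) + (h (y / \<alpha>) - h (x / \<alpha>))) / \<alpha>"
      by (simp add: f'_def diff_divide_distrib add_divide_distrib)
    then have "\<bar>f' y - f' x\<bar> \<le> ((y - x) / \<alpha> + (y - x) / \<alpha>) / \<alpha>"
      using * \<alpha> by (simp add: abs_divide)
    also have "\<dots> = 2 / \<alpha>\<^sup>2 * (y - x)" using \<alpha> by (simp add: field_simps power2_eq_square)
    finally show ?thesis .
  qed
  obtain F where "\<forall>x. (F has_vector_derivative f x) (at x)"
    using einterval_antiderivative[of "-\<infinity>" "\<infinity>" f] f_cont by auto
  then have F: "(F has_real_derivative f x) (at x)" for x
    by (simp add: has_real_derivative_iff_has_vector_derivative)
  \<comment> \<open>The antiderivative is fixed only up to a constant, hence the term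
    \<open>\<bar>F 0\<bar>\<close>; the other term serves the bounds
    \<open>x\<^sup>2 / \<alpha>\<close> for \<open>F x - F 0\<close> and \<open>x / \<alpha>\<close>
    for \<open>f x\<close>.\<close>
  define K where "K = \<bar>F 0\<bar> + 1 / \<alpha>"
  have growth: "\<bar>F x\<bar> \<le> K * (1 + x\<^sup>2)" "\<bar>f x\<bar> \<le> K * (1 + x\<^sup>2)" if x: "0 \<le> x" for x
  proof -
    have *: "\<bar>F 0\<bar> + x\<^sup>2 / \<alpha> \<le> K * (1 + x\<^sup>2)" "(1 + x\<^sup>2) / \<alpha> \<le> K * (1 + x\<^sup>2)"
      using \<alpha> by (simp_all add: K_def algebra_simps add_divide_distrib)
    have "x / \<alpha> \<le> (1 + x\<^sup>2) / \<alpha>"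
      using power_le_one_add_power[OF x, of 1 2] \<alpha> by (intro divide_right_mono) auto
    then show "\<bar>f x\<bar> \<le> K * (1 + x\<^sup>2)" using f_bound[of x] *(2) x by simp
    have "\<bar>F x - F 0\<bar> \<le> x\<^sup>2 / \<alpha>"
    proof (cases "x = 0")
      case False
      then obtain \<xi> where \<xi>: "0 < \<xi>" "\<xi> < x" "F x - F 0 = (x - 0) * f \<xi>"
        using MVT2[of 0 x F f] F x by auto
      have "\<bar>f \<xi>\<bar> \<le> x / \<alpha>"
        using f_bound[of \<xi>] divide_right_mono[of \<xi> x \<alpha>] \<xi> \<alpha> by simp
      then have "x * \<bar>f \<xi>\<bar> \<le> x * (x / \<alpha>)" using x by (rule mult_left_mono)
      then show ?thesis using \<xi>(3) x by (simp add: abs_mult power2_eq_square)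
    qed simp
    then show "\<bar>F x\<bar> \<le> K * (1 + x\<^sup>2)" using *(1) by simp
  qed
  have f_cont': "continuous_on UNIV f" and f0: "f 0 = 0"
    using f_cont by (simp_all add: continuous_at_imp_continuous_on) (simp add: f_def)
  have "\<forall>x\<ge>0. \<bar>F x\<bar> \<le> K * (1 + x\<^sup>2)" "\<forall>x\<ge>0. \<bar>f x\<bar> \<le> K * (1 + x\<^sup>2)"
    using growth by auto
  note rec = walk_sup_recursion[OF F f_cont' f0 this]
  have h_int: "integrable Q (\<lambda>\<omega>. h (walk_sup \<omega> / \<alpha>))"
    by (rule integrable_lipschitz[OF Q.P.finite_measure_axioms h]) (use walk_sup_integrable in simp)
  have f'_eq: "f' x = (f x + h (x / \<alpha>) - \<mu>) / \<alpha>" for x by (simp add: f'_def f_def)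
  have f'_int: "integrable Q (\<lambda>\<omega>. f' (walk_sup \<omega>))"
    unfolding f'_eq using rec(2) h_int by simp
  have f'_mean: "(\<integral>\<omega>. f' (walk_sup \<omega>) \<partial>Q)
      = ((\<integral>\<omega>. f (walk_sup \<omega>) \<partial>Q) + (\<integral>\<omega>. h (walk_sup \<omega> / \<alpha>) \<partial>Q) - \<mu>) / \<alpha>"
    unfolding f'_eq using rec(2) h_int Q.P.prob_space by simp
  \<comment> \<open>The second-order Taylor remainder, arranged with a factor 1 so that each
    subtracted term is a product of functions of the two coordinates.\<close>
  define R where "R p = F (fst p + walk_sup (snd p)) - 1 * F (walk_sup (snd p))
      - fst p * f (walk_sup (snd p)) - (fst p)\<^sup>2 * (f' (walk_sup (snd p)) / 2)" for p
  have f'_half: "integrable Q (\<lambda>\<omega>. f' (walk_sup \<omega>) / 2)" using f'_int by simp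
  note ints = rec(3) LQ.product_integrable_mult[OF L.integrable_const rec(1), of 1]
    LQ.product_integrable_mult[OF integrable_L_id rec(2)]
    LQ.product_integrable_mult[OF integrable_L_sq f'_half]
  have R_int: "integrable (L \<Otimes>\<^sub>M Q) R"
    unfolding R_def using ints by (intro Bochner_Integration.integrable_diff) auto
  have R_eq: "(\<integral>p. R p \<partial>(L \<Otimes>\<^sub>M Q)) = (\<integral>p. F (fst p + walk_sup (snd p)) \<partial>(L \<Otimes>\<^sub>M Q))
      - (\<integral>\<omega>. F (walk_sup \<omega>) \<partial>Q) - (\<integral>a. a \<partial>L) * (\<integral>\<omega>. f (walk_sup \<omega>) \<partial>Q)
      - (\<integral>a. a\<^sup>2 \<partial>L) * ((\<integral>\<omega>. f' (walk_sup \<omega>) \<partial>Q) / 2)"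
    unfolding R_def using ints
    by (simp add: Bochner_Integration.integral_diff Bochner_Integration.integrable_diff)
  have cube_int: "integrable (L \<Otimes>\<^sub>M Q) (\<lambda>p. fst p ^ 3)"
    and cube_eq: "(\<integral>p. fst p ^ 3 \<partial>(L \<Otimes>\<^sub>M Q)) = (\<integral>a. a ^ 3 \<partial>L)"
    using LQ.product_integrable_mult[OF L_int3, of "\<lambda>_. 1"] by (simp_all add: Q.P.prob_space)
  have "\<bar>\<integral>p. R p \<partial>(L \<Otimes>\<^sub>M Q)\<bar> \<le> (\<integral>p. \<bar>R p\<bar> \<partial>(L \<Otimes>\<^sub>M Q))" by (rule integral_abs_bound)
  also have "\<dots> \<le> (\<integral>p. 2 / \<alpha>\<^sup>2 / 6 * fst p ^ 3 \<partial>(L \<Otimes>\<^sub>M Q))"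
  proof (rule integral_mono_AE)
    show "AE p in L \<Otimes>\<^sub>M Q. \<bar>R p\<bar> \<le> 2 / \<alpha>\<^sup>2 / 6 * fst p ^ 3"
      using AE_fst_LQ[OF L_nonneg] AE_snd_LQ[OF AE_walk_sup_nonneg]
    proof eventually_elim
      case (elim p)
      show ?case
        using taylor2_lipschitz_bound[OF F f_deriv lip' elim(2) elim(1)]
        by (simp add: R_def algebra_simps)
    qed
  qed (use R_int cube_int in auto)
  also have "\<dots> = (\<integral>a. a ^ 3 \<partial>L) / (3 * \<alpha>\<^sup>2)" by (simp add: cube_eq)
  finally have R_bound: "\<bar>\<integral>p. R p \<partial>(L \<Otimes>\<^sub>M Q)\<bar> \<le> (\<integral>a. a ^ 3 \<partial>L) / (3 * \<alpha>\<^sup>2)" .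
  let ?D = "(\<integral>\<omega>. h (walk_sup \<omega> / \<alpha>) \<partial>Q) - \<mu>"
  \<comment> \<open>With this identity the coefficient of the mean of \<open>f\<close> from the
    second-order term equals the one from the recursion, so they cancel.\<close>
  have c: "(\<integral>a. a\<^sup>2 \<partial>L) / (2 * \<alpha>) = (1 - \<rho>) / lam"
    using m2 lam \<rho> by (simp add: \<alpha>_def field_simps)
  have "(\<integral>p. R p \<partial>(L \<Otimes>\<^sub>M Q)) = (1 - \<rho>) / lam * (\<integral>\<omega>. f (walk_sup \<omega>) \<partial>Q)
      - (\<integral>a. a\<^sup>2 \<partial>L) / (2 * \<alpha>) * ((\<integral>\<omega>. f (walk_sup \<omega>) \<partial>Q) + ?D)"
    unfolding R_eq f'_mean rec(4)[symmetric] \<rho>_def using lam by (simp add: field_simps)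
  also have "\<dots> = - ((1 - \<rho>) / lam * ?D)" unfolding c by (simp add: algebra_simps)
  finally have "(1 - \<rho>) / lam * \<bar>?D\<bar> \<le> (\<integral>a. a ^ 3 \<partial>L) / (3 * \<alpha>\<^sup>2)"
    using R_bound \<rho> lam by (simp add: abs_mult)
  then have "\<bar>?D\<bar> \<le> (\<integral>a. a ^ 3 \<partial>L) / (3 * \<alpha>\<^sup>2) / ((1 - \<rho>) / lam)"
    using \<rho> lam by (subst pos_le_divide_eq) (auto simp: mult.commute)
  also have "\<dots> = 4 * (\<integral>a. a ^ 3 \<partial>L) / (3 * lam * (\<integral>a. a\<^sup>2 \<partial>L)\<^sup>2) * (1 - \<rho>)"
    using \<rho> lam m2 by (simp add: \<alpha>_def field_simps power2_eq_square)
  finally show ?thesis by (simp add: \<mu>_def)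
qed

text \<open>The recursion with \<open>F' x = 1 - exp (- \<theta> * x)\<close> gives the
  Pollaczek-Khinchine equation for the transform of \<open>walk_sup\<close> at
  \<open>\<theta> = 1 / \<alpha>\<close>. The cubic bound on the transform of the service time then
  pushes the solution above \<open>1 / 2\<close>. The condition \<open>1 \<le> \<alpha>\<close> lets
  the gain be measured by a moment free of \<open>lam\<close>.\<close>

lemma laplace_lower_bound:
  assumes m2: "0 < (\<integral>a. a\<^sup>2 \<partial>L)"
  defines "\<rho> \<equiv> lam * (\<integral>a. a \<partial>L)"
  defines "\<alpha> \<equiv> lam * (\<integral>a. a\<^sup>2 \<partial>L) / (2 * (1 - \<rho>))"
  assumes \<alpha>1: "1 \<le> \<alpha>"
  shows "(\<integral>a. a ^ 3 * exp (- a) \<partial>L) * (1 - \<rho>) / (6 * lam * (\<integral>a. a\<^sup>2 \<partial>L)\<^sup>2)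
    \<le> (\<integral>\<omega>. exp (- (walk_sup \<omega> / \<alpha>)) \<partial>Q) - 1 / 2"
proof -
  define \<theta> where "\<theta> = 1 / \<alpha>"
  have \<rho>: "\<rho> < 1" using load_less_1 by (simp add: \<rho>_def)
  have \<theta>: "0 < \<theta>" "\<theta> \<le> 1" using \<alpha>1 by (auto simp: \<theta>_def)
  have \<theta>_eq: "\<theta> = 2 * (1 - \<rho>) / (lam * (\<integral>a. a\<^sup>2 \<partial>L))" by (simp add: \<theta>_def \<alpha>_def)
  define m where "m = (\<integral>a. a ^ 3 * exp (- a) \<partial>L)"
  have m_int: "integrable L (\<lambda>a. a ^ 3 * exp (- a))"
    by (rule Bochner_Integration.integrable_bound[OF L_int3])
       (use L_nonneg in \<open>auto elim!: eventually_mono simp: abs_mult mult_left_le\<close>)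
  have m_nonneg: "0 \<le> m" unfolding m_def
    using L_nonneg by (intro integral_nonneg_AE) (auto elim!: eventually_mono)
  define F f where "F x = x + exp (- (\<theta> * x)) / \<theta>" and "f x = 1 - exp (- (\<theta> * x))" for x
  have F: "(F has_real_derivative f x) (at x)" for x
    unfolding F_def f_def using \<theta> by (auto intro!: derivative_eq_intros)
  have growth: "\<bar>F x\<bar> \<le> (1 + 1 / \<theta>) * (1 + x\<^sup>2)" "\<bar>f x\<bar> \<le> (1 + 1 / \<theta>) * (1 + x\<^sup>2)" if x: "0 \<le> x" for x
  proof -
    have e: "exp (- (\<theta> * x)) \<le> 1" using x \<theta> by simp
    have e': "exp (- (\<theta> * x)) \<le> 1 + x\<^sup>2" by (rule order_trans[OF e]) simp
    have "x + exp (- (\<theta> * x)) / \<theta> \<le> (1 + x\<^sup>2) + (1 + x\<^sup>2) / \<theta>"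
      using power_le_one_add_power[OF x, of 1 2] e' \<theta> by (intro add_mono divide_right_mono) auto
    then show "\<bar>F x\<bar> \<le> (1 + 1 / \<theta>) * (1 + x\<^sup>2)"
      using x \<theta> by (simp add: F_def algebra_simps add_divide_distrib)
    have "1 \<le> (1 + 1 / \<theta>) * (1 + x\<^sup>2)"
      using \<theta> by (simp add: algebra_simps)
    then show "\<bar>f x\<bar> \<le> (1 + 1 / \<theta>) * (1 + x\<^sup>2)"
      unfolding f_def using e exp_gt_zero[of "- (\<theta> * x)"] by linarith
  qed
  have "continuous_on UNIV f" "f 0 = 0"
    "\<forall>x\<ge>0. \<bar>F x\<bar> \<le> (1 + 1 / \<theta>) * (1 + x\<^sup>2)" "\<forall>x\<ge>0. \<bar>f x\<bar> \<le> (1 + 1 / \<theta>) * (1 + x\<^sup>2)"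
    using growth by (auto simp: f_def intro!: continuous_intros)
  note rec = walk_sup_recursion[OF F this]
  have W_exp: "integrable Q (\<lambda>\<omega>. exp (- (\<theta> * walk_sup \<omega>)))"
    by (rule Q.P.integrable_const_bound[where B=1])
       (use AE_walk_sup_nonneg \<theta> in \<open>auto elim!: eventually_mono\<close>)
  have L_exp: "integrable L (\<lambda>a. exp (- (\<theta> * a)))"
    by (rule L.integrable_const_bound[where B=1])
       (use L_nonneg \<theta> in \<open>auto elim!: eventually_mono\<close>)
  define \<Lambda> where "\<Lambda> = (\<integral>\<omega>. exp (- (\<theta> * walk_sup \<omega>)) \<partial>Q)"
  define e where "e = (\<integral>a. exp (- (\<theta> * a)) \<partial>L)"
  let ?w = "\<integral>\<omega>. walk_sup \<omega> \<partial>Q"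
  have "(\<integral>\<omega>. F (walk_sup \<omega>) \<partial>Q) = ?w + \<Lambda> / \<theta>"
    unfolding F_def \<Lambda>_def using walk_sup_integrable W_exp by simp
  moreover have "(\<integral>\<omega>. f (walk_sup \<omega>) \<partial>Q) = 1 - \<Lambda>"
    unfolding f_def \<Lambda>_def using W_exp Q.P.prob_space by simp
  moreover have "(\<integral>p. F (fst p + walk_sup (snd p)) \<partial>(L \<Otimes>\<^sub>M Q)) = (\<integral>a. a \<partial>L) + ?w + e * \<Lambda> / \<theta>"
  proof -
    have "(\<integral>p. F (fst p + walk_sup (snd p)) \<partial>(L \<Otimes>\<^sub>M Q))
      = (\<integral>p. fst p * 1 + 1 * walk_sup (snd p) + exp (- (\<theta> * fst p)) * exp (- (\<theta> * walk_sup (snd p))) / \<theta> \<partial>(L \<Otimes>\<^sub>M Q))"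
      by (simp add: F_def mult_exp_exp algebra_simps)
    also have "\<dots> = (\<integral>a. a \<partial>L) + ?w + e * \<Lambda> / \<theta>"
      using LQ.product_integrable_mult[OF integrable_L_id, of "\<lambda>_. 1"]
        LQ.product_integrable_mult[OF _ walk_sup_integrable, of "\<lambda>_. 1"]
        LQ.product_integrable_mult[OF L_exp W_exp]
      by (simp add: Q.P.prob_space e_def \<Lambda>_def)
    finally show ?thesis .
  qed
  ultimately have "\<Lambda> / \<theta> + (1 - \<Lambda>) / lam = (\<integral>a. a \<partial>L) + e * \<Lambda> / \<theta>"
    using rec(4) by simp
  then have "(1 - \<Lambda>) / lam = (\<integral>a. a \<partial>L) + \<Lambda> * ((e - 1) / \<theta>)"
    by (simp add: algebra_simps diff_divide_distrib)
  then have "1 - \<Lambda> = lam * ((\<integral>a. a \<partial>L) + \<Lambda> * ((e - 1) / \<theta>))"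
    using lam by (metis nonzero_divide_eq_eq less_irrefl mult.commute)
  then have eq: "1 - \<Lambda> = \<rho> + lam * \<Lambda> * ((e - 1) / \<theta>)"
    by (simp add: \<rho>_def algebra_simps)
  have e_le: "e \<le> 1 - \<theta> * (\<integral>a. a \<partial>L) + \<theta>\<^sup>2 * (\<integral>a. a\<^sup>2 \<partial>L) / 2 - \<theta> ^ 3 * m / 6"
  proof -
    have "e \<le> (\<integral>a. 1 - \<theta> * a + \<theta>\<^sup>2 * a\<^sup>2 / 2 - \<theta> ^ 3 * (a ^ 3 * exp (- a)) / 6 \<partial>L)"
      unfolding e_def
    proof (rule integral_mono_AE[OF L_exp])
      show "AE a in L. exp (- (\<theta> * a)) \<le> 1 - \<theta> * a + \<theta>\<^sup>2 * a\<^sup>2 / 2 - \<theta> ^ 3 * (a ^ 3 * exp (- a)) / 6"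
        using L_nonneg
      proof eventually_elim
        case (elim a)
        \<comment> \<open>As \<open>\<theta>\<close> is at most 1, the weight
          \<open>exp (- \<theta> * a)\<close> may be lowered to \<open>exp (- a)\<close>, which no
          longer depends on the load.\<close>
        have "(\<theta> * a) ^ 3 * exp (- a) \<le> (\<theta> * a) ^ 3 * exp (- (\<theta> * a))"
          using elim \<theta> by (intro mult_left_mono) (auto simp: mult_left_le_one_le)
        moreover have "exp (- (\<theta> * a)) \<le> 1 - \<theta> * a + (\<theta> * a)\<^sup>2 / 2 - (\<theta> * a) ^ 3 * exp (- (\<theta> * a)) / 6"
          using elim \<theta> by (intro exp_minus_le_cubic) simp
        ultimately have "exp (- (\<theta> * a)) \<le> 1 - \<theta> * a + (\<theta> * a)\<^sup>2 / 2 - (\<theta> * a) ^ 3 * exp (- a) / 6"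
          by linarith
        then show ?case by (simp add: power_mult_distrib mult.assoc)
      qed
    qed (use integrable_L_id integrable_L_sq m_int in simp)
    also have "\<dots> = 1 - \<theta> * (\<integral>a. a \<partial>L) + \<theta>\<^sup>2 * (\<integral>a. a\<^sup>2 \<partial>L) / 2 - \<theta> ^ 3 * m / 6"
      unfolding m_def using integrable_L_id integrable_L_sq m_int by simp
    finally show ?thesis .
  qed
  have \<Lambda>0: "0 \<le> \<Lambda>" unfolding \<Lambda>_def by (rule integral_nonneg_AE) simp
  \<comment> \<open>Chosen so that \<open>lam * \<theta>\<^sup>2 * m / 6\<close> equals
    \<open>(1 - \<rho>) * \<delta>\<close>, just as \<open>lam * \<theta>\<close> times half the
    second moment equals \<open>1 - \<rho>\<close>; the common factor then divides out.\<close>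
  define \<delta> where "\<delta> = 2 * m * (1 - \<rho>) / (3 * lam * (\<integral>a. a\<^sup>2 \<partial>L)\<^sup>2)"
  have \<delta>: "0 \<le> \<delta>" unfolding \<delta>_def using m_nonneg \<rho> lam by simp
  have "(e - 1) / \<theta> \<le> (- \<theta> * (\<integral>a. a \<partial>L) + \<theta>\<^sup>2 * (\<integral>a. a\<^sup>2 \<partial>L) / 2 - \<theta> ^ 3 * m / 6) / \<theta>"
    using e_le \<theta> by (intro divide_right_mono) auto
  also have "\<dots> = - (\<integral>a. a \<partial>L) + \<theta> * (\<integral>a. a\<^sup>2 \<partial>L) / 2 - \<theta>\<^sup>2 * m / 6"
    using \<theta> by (simp add: field_simps power2_eq_square power3_eq_cube)
  finally have "lam * \<Lambda> * ((e - 1) / \<theta>)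
      \<le> lam * \<Lambda> * (- (\<integral>a. a \<partial>L) + \<theta> * (\<integral>a. a\<^sup>2 \<partial>L) / 2 - \<theta>\<^sup>2 * m / 6)"
    using lam \<Lambda>0 by (intro mult_left_mono) auto
  also have "\<dots> = \<Lambda> * (- \<rho> + (1 - \<rho>) - (1 - \<rho>) * \<delta>)"
    using lam m2 by (simp add: \<theta>_eq \<rho>_def \<delta>_def field_simps power2_eq_square)
  finally have "lam * \<Lambda> * ((e - 1) / \<theta>) \<le> \<Lambda> * (- \<rho> + (1 - \<rho>) - (1 - \<rho>) * \<delta>)" .
  with eq have "1 - \<rho> \<le> \<Lambda> + \<Lambda> * (- \<rho> + (1 - \<rho>) - (1 - \<rho>) * \<delta>)"
    by linarith
  then have "(1 - \<rho>) * 1 \<le> (1 - \<rho>) * (\<Lambda> * (2 - \<delta>))"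
    by (simp add: algebra_simps)
  then have *: "1 \<le> \<Lambda> * (2 - \<delta>)" using \<rho> by simp
  \<comment> \<open>Bootstrap: the inequality first gives the crude bound \<open>1 / 2\<close> for
    \<open>\<Lambda>\<close>, and inserting that into the term \<open>\<Lambda> * \<delta>\<close>
    yields the gain \<open>\<delta> / 4\<close>.\<close>
  have "0 \<le> \<Lambda> * \<delta>" using \<Lambda>0 \<delta> by simp
  then have "1 / 2 \<le> \<Lambda>" using * by (simp add: algebra_simps)
  then have "1 / 2 * \<delta> \<le> \<Lambda> * \<delta>" using \<delta> by (rule mult_right_mono)
  then have "\<delta> / 4 \<le> \<Lambda> - 1 / 2" using * by (simp add: algebra_simps)
  then show ?thesis
    by (simp add: \<delta>_def m_def \<Lambda>_def \<theta>_def mult.commute mult.left_commute)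
qed

end

lemma exp_minus_lipschitz: "1-lipschitz_on {0..} (\<lambda>x::real. exp (- x))"
proof (rule lipschitz_onI)
  have le: "\<bar>exp (- x) - exp (- y)\<bar> \<le> y - x" if "0 \<le> x" "x \<le> y" for x y :: real
  proof -
    have "exp (- x) - exp (- y) = exp (- x) * (1 - exp (x - y))"
      by (simp add: algebra_simps mult_exp_exp)
    also have "\<dots> \<le> 1 * (y - x)"
    proof (rule mult_mono)
      show "1 - exp (x - y) \<le> y - x" using exp_ge_add_one_self[of "x - y"] by linarith
    qed (use that in auto)
    finally show ?thesis using that by simp
  qed
  fix x y :: real assume "x \<in> {0..}" "y \<in> {0..}"
  then show "dist (exp (- x)) (exp (- y)) \<le> 1 * dist x y"
    using le[of x y] le[of y x] by (cases "x \<le> y") (auto simp: dist_real_def)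
qed simp

section \<open>Distances of the rescaled waiting time from the exponential law\<close>

context stable_mg1
begin

lemma AE_law_walk_sup_nonneg:
  assumes "0 \<le> c"
  shows "AE x in law Q (\<lambda>\<omega>. c * walk_sup \<omega>). 0 \<le> x"
  by (subst AE_distr_iff) (use AE_walk_sup_nonneg assms in \<open>auto elim!: eventually_mono\<close>)

text \<open>The case \<open>r = 1\<close> is \<open>W_tilde\<close> and \<open>r = \<rho>\<close> is
  \<open>W_hat\<close>. The triangle inequality through the law of \<open>r * Z\<close> gives
  \<open>r\<close> times the Stein bound plus the mean of \<open>Z - r * Z\<close>, that is
  \<open>1 - r\<close>.\<close>

lemma wasserstein_scaled_le:
  assumes m2: "0 < (\<integral>a. a\<^sup>2 \<partial>L)" and r: "0 < r" "r \<le> 1"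
  defines "\<rho> \<equiv> lam * (\<integral>a. a \<partial>L)"
  defines "\<alpha> \<equiv> lam * (\<integral>a. a\<^sup>2 \<partial>L) / (2 * (1 - \<rho>))"
  shows "wasserstein (law Q (\<lambda>\<omega>. r / \<alpha> * waiting_time \<omega>)) (exp_law 1)
    \<le> ereal (r * (4 * (\<integral>a. a ^ 3 \<partial>L) / (3 * lam * (\<integral>a. a\<^sup>2 \<partial>L)\<^sup>2) * (1 - \<rho>)) + (1 - r))"
  unfolding law_waiting_time
proof (rule wasserstein_le)
  have \<rho>: "\<rho> < 1" using load_less_1 by (simp add: \<rho>_def)
  have \<alpha>: "0 < \<alpha>" using m2 lam \<rho> by (simp add: \<alpha>_def)
  interpret Z: prob_space "exp_law 1" by (rule prob_space_exp_law) simp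
  note meanZ = exp_law_mean[of 1, simplified]
  show "AE x in law Q (\<lambda>\<omega>. r / \<alpha> * walk_sup \<omega>). 0 \<le> x"
    using \<alpha> r by (intro AE_law_walk_sup_nonneg) auto
  show "AE x in exp_law 1. 0 \<le> x" by (rule AE_exp_law_nonneg) simp
  fix h :: "real \<Rightarrow> real" assume h: "1-lipschitz_on UNIV h"
  note [measurable] = lipschitz_borel_measurable[OF h]
  \<comment> \<open>Dividing by \<open>r\<close> restores Lipschitz constant 1, so the Stein bound
    for \<open>k\<close> becomes \<open>r\<close> times that bound for \<open>h\<close>.\<close>
  define k where "k x = h (r * x) / r" for x
  have k: "1-lipschitz_on UNIV k"
  proof (rule lipschitz_onI)
    fix x y
    have "\<bar>h (r * x) - h (r * y)\<bar> / r \<le> r * \<bar>x - y\<bar> / r"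
      using lipschitz_real_bound[OF h, of "r * x" "r * y"] r
      by (intro divide_right_mono) (auto simp: abs_mult simp flip: right_diff_distrib)
    then show "dist (k x) (k y) \<le> 1 * dist x y"
      using r by (simp add: k_def dist_real_def abs_divide flip: diff_divide_distrib)
  qed simp
  have hZ: "integrable (exp_law 1) h" "integrable (exp_law 1) (\<lambda>z. h (r * z))"
    using integrable_lipschitz[OF Z.finite_measure_axioms h meanZ(1)]
      integrable_lipschitz[OF Z.finite_measure_axioms h, of "\<lambda>z. r * z"] meanZ(1) by simp_all
  have "\<bar>(\<integral>\<omega>. k (walk_sup \<omega> / \<alpha>) \<partial>Q) - (\<integral>z. k z \<partial>exp_law 1)\<bar>
      \<le> 4 * (\<integral>a. a ^ 3 \<partial>L) / (3 * lam * (\<integral>a. a\<^sup>2 \<partial>L)\<^sup>2) * (1 - \<rho>)" (is "?K \<le> ?B")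
    using stein_bound[OF k m2] by (simp add: \<alpha>_def \<rho>_def)
  then have "r * ?K \<le> r * ?B" using r by (intro mult_left_mono) auto
  moreover have "r * ?K = \<bar>(\<integral>\<omega>. h (r / \<alpha> * walk_sup \<omega>) \<partial>Q) - (\<integral>z. h (r * z) \<partial>exp_law 1)\<bar>"
    using r by (simp add: k_def abs_divide flip: diff_divide_distrib)
  moreover have "\<bar>(\<integral>z. h (r * z) \<partial>exp_law 1) - (\<integral>z. h z \<partial>exp_law 1)\<bar> \<le> 1 - r"
  proof -
    have "\<bar>(\<integral>z. h (r * z) \<partial>exp_law 1) - (\<integral>z. h z \<partial>exp_law 1)\<bar> = \<bar>\<integral>z. h (r * z) - h z \<partial>exp_law 1\<bar>"
      using hZ by simp
    also have "\<dots> \<le> (\<integral>z. \<bar>h (r * z) - h z\<bar> \<partial>exp_law 1)" by (rule integral_abs_bound)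
    also have "\<dots> \<le> (\<integral>z. (1 - r) * z \<partial>exp_law 1)"
    proof (rule integral_mono_AE)
      have "AE z in exp_law 1. 0 \<le> z" by (rule AE_exp_law_nonneg) simp
      then show "AE z in exp_law 1. \<bar>h (r * z) - h z\<bar> \<le> (1 - r) * z"
      proof eventually_elim
        case (elim z)
        then have "r * z \<le> z" using r by (simp add: mult_left_le_one_le)
        then show ?case using lipschitz_real_bound[OF h, of "r * z" z] by (simp add: algebra_simps)
      qed
    qed (use hZ meanZ in auto)
    also have "\<dots> = 1 - r" using meanZ by simp
    finally show ?thesis .
  qed
  ultimately show "\<bar>(\<integral>x. h x \<partial>law Q (\<lambda>\<omega>. r / \<alpha> * walk_sup \<omega>)) - (\<integral>x. h x \<partial>exp_law 1)\<bar> \<le> r * ?B + (1 - r)"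
    by (simp add: integral_distr)
qed simp_all

text \<open>The identity is an admissible test function, and the two means are \<open>r\<close> and
  1 because \<open>\<alpha>\<close> is the mean of \<open>walk_sup\<close>.\<close>

lemma wasserstein_scaled_ge_mean:
  assumes m2: "0 < (\<integral>a. a\<^sup>2 \<partial>L)" and r: "0 \<le> r"
  defines "\<rho> \<equiv> lam * (\<integral>a. a \<partial>L)"
  defines "\<alpha> \<equiv> lam * (\<integral>a. a\<^sup>2 \<partial>L) / (2 * (1 - \<rho>))"
  shows "ereal \<bar>r - 1\<bar> \<le> wasserstein (law Q (\<lambda>\<omega>. r / \<alpha> * waiting_time \<omega>)) (exp_law 1)"
  unfolding law_waiting_time
proof -
  have \<rho>: "\<rho> < 1" using load_less_1 by (simp add: \<rho>_def)
  have \<alpha>: "0 < \<alpha>" using m2 lam \<rho> by (simp add: \<alpha>_def)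
  have nn: "AE x in law Q (\<lambda>\<omega>. r / \<alpha> * walk_sup \<omega>). 0 \<le> x"
    using \<alpha> r by (intro AE_law_walk_sup_nonneg) auto
  have nnZ: "AE x in exp_law 1. 0 \<le> x" by (rule AE_exp_law_nonneg) simp
  have "(\<integral>x. max 0 x \<partial>law Q (\<lambda>\<omega>. r / \<alpha> * walk_sup \<omega>)) = (\<integral>x. x \<partial>law Q (\<lambda>\<omega>. r / \<alpha> * walk_sup \<omega>))"
    by (rule integral_cong_AE) (use nn in \<open>auto elim!: eventually_mono\<close>)
  also have "\<dots> = r / \<alpha> * (\<integral>\<omega>. walk_sup \<omega> \<partial>Q)" by (subst integral_distr) auto
  also have "\<dots> = r"
    unfolding walk_sup_mean \<rho>_def[symmetric] \<alpha>_def[symmetric] using \<alpha> by simp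
  finally have 1: "(\<integral>x. max 0 x \<partial>law Q (\<lambda>\<omega>. r / \<alpha> * walk_sup \<omega>)) = r" .
  have "(\<integral>x. max 0 x \<partial>exp_law 1) = (\<integral>x. x \<partial>exp_law 1)"
    by (rule integral_cong_AE) (use nnZ in \<open>auto elim!: eventually_mono\<close>)
  then have 2: "(\<integral>x. max 0 x \<partial>exp_law 1) = 1" using exp_law_mean[of 1] by simp
  have "1-lipschitz_on {0..} (\<lambda>x::real. x)" by (rule lipschitz_onI) auto
  from wasserstein_ge[OF _ nn _ nnZ this] 1 2
  show "ereal \<bar>r - 1\<bar> \<le> wasserstein (law Q (\<lambda>\<omega>. r / \<alpha> * walk_sup \<omega>)) (exp_law 1)"
    by simp
qed

lemma wasserstein_ge_laplace:
  assumes m2: "0 < (\<integral>a. a\<^sup>2 \<partial>L)"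
  defines "\<rho> \<equiv> lam * (\<integral>a. a \<partial>L)"
  defines "\<alpha> \<equiv> lam * (\<integral>a. a\<^sup>2 \<partial>L) / (2 * (1 - \<rho>))"
  assumes \<alpha>1: "1 \<le> \<alpha>"
  shows "ereal ((\<integral>a. a ^ 3 * exp (- a) \<partial>L) * (1 - \<rho>) / (6 * lam * (\<integral>a. a\<^sup>2 \<partial>L)\<^sup>2))
    \<le> wasserstein (law Q (\<lambda>\<omega>. 1 / \<alpha> * waiting_time \<omega>)) (exp_law 1)"
  unfolding law_waiting_time
proof -
  have nn: "AE x in law Q (\<lambda>\<omega>. 1 / \<alpha> * walk_sup \<omega>). 0 \<le> x"
    using \<alpha>1 by (intro AE_law_walk_sup_nonneg) auto
  have nnZ: "AE x in exp_law 1. 0 \<le> x" by (rule AE_exp_law_nonneg) simp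
  have "(\<integral>x. exp (- max 0 x) \<partial>law Q (\<lambda>\<omega>. 1 / \<alpha> * walk_sup \<omega>)) = (\<integral>x. exp (- x) \<partial>law Q (\<lambda>\<omega>. 1 / \<alpha> * walk_sup \<omega>))"
    by (rule integral_cong_AE) (use nn in \<open>auto elim!: eventually_mono\<close>)
  also have "\<dots> = (\<integral>\<omega>. exp (- (walk_sup \<omega> / \<alpha>)) \<partial>Q)" by (subst integral_distr) auto
  finally have 1: "(\<integral>x. exp (- max 0 x) \<partial>law Q (\<lambda>\<omega>. 1 / \<alpha> * walk_sup \<omega>)) = (\<integral>\<omega>. exp (- (walk_sup \<omega> / \<alpha>)) \<partial>Q)" .
  have "(\<integral>x. exp (- max 0 x) \<partial>exp_law 1) = (\<integral>x. exp (- x) \<partial>exp_law 1)"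
    by (rule integral_cong_AE) (use nnZ in \<open>auto elim!: eventually_mono\<close>)
  then have 2: "(\<integral>x. exp (- max 0 x) \<partial>exp_law 1) = 1 / 2" using exp_law_one_integral_exp_minus by simp
  have "(\<integral>a. a ^ 3 * exp (- a) \<partial>L) * (1 - \<rho>) / (6 * lam * (\<integral>a. a\<^sup>2 \<partial>L)\<^sup>2)
      \<le> \<bar>(\<integral>x. exp (- max 0 x) \<partial>law Q (\<lambda>\<omega>. 1 / \<alpha> * walk_sup \<omega>)) - (\<integral>x. exp (- max 0 x) \<partial>exp_law 1)\<bar>"
    unfolding 1 2
    using laplace_lower_bound[OF m2] \<alpha>1 by (fastforce simp: \<alpha>_def \<rho>_def intro: order_trans)
  also have "ereal \<dots> \<le> wasserstein (law Q (\<lambda>\<omega>. 1 / \<alpha> * walk_sup \<omega>)) (exp_law 1)"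
    by (rule wasserstein_ge[OF _ nn _ nnZ exp_minus_lipschitz]) simp_all
  finally show "ereal ((\<integral>a. a ^ 3 * exp (- a) \<partial>L) * (1 - \<rho>) / (6 * lam * (\<integral>a. a\<^sup>2 \<partial>L)\<^sup>2))
    \<le> wasserstein (law Q (\<lambda>\<omega>. 1 / \<alpha> * walk_sup \<omega>)) (exp_law 1)" by simp
qed

end

text \<open>Optimality is rendered as a matching lower bound of order \<open>1 - \<rho>\<close> for
  every fixed service law, with the arrival rate recovered from the load.\<close>

theorem theorem1p1:
  fixes M :: "'a measure" and S :: "'a \<Rightarrow> real"
  assumes "prob_space M"
    and "S \<in> borel_measurable M"
    and "AE \<omega> in M. 0 \<le> S \<omega>"
    and "0 < (\<integral>\<omega>. S \<omega> \<partial>M)"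
    and "integrable M (\<lambda>\<omega>. S \<omega> ^ 3)"
  shows "(\<forall>lam \<rho>. 0 < lam \<longrightarrow> \<rho> = load M S lam \<longrightarrow> 0 < \<rho> \<longrightarrow> \<rho> < 1 \<longrightarrow>
             dist_tilde M S lam \<le> ereal (bound_const M S * ((1 - \<rho>) / \<rho>)) \<and>
             ereal (1 - \<rho>) \<le> dist_hat M S lam \<and>
             dist_hat M S lam \<le> ereal ((1 + bound_const M S) * (1 - \<rho>))) \<and>
         (\<exists>c>0. \<forall>\<^sub>F \<rho> in at_left (1::real).
             ereal (c * (1 - \<rho>)) \<le> dist_tilde M S (\<rho> / (\<integral>\<omega>. S \<omega> \<partial>M)))"
proof -
  interpret M: prob_space M by fact
  note [measurable] = assms(2)
  define L where "L = law M S"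
  have moments: "(\<integral>a. a ^ k \<partial>L) = (\<integral>\<omega>. S \<omega> ^ k \<partial>M)" for k
    unfolding L_def by (subst integral_distr) auto
  define m1 m2 m3 where "m1 = (\<integral>\<omega>. S \<omega> \<partial>M)" and "m2 = (\<integral>\<omega>. (S \<omega>)\<^sup>2 \<partial>M)" and "m3 = (\<integral>\<omega>. S \<omega> ^ 3 \<partial>M)"
  have L1: "(\<integral>a. a \<partial>L) = m1" and L2: "(\<integral>a. a\<^sup>2 \<partial>L) = m2" and L3: "(\<integral>a. a ^ 3 \<partial>L) = m3"
    using moments[of 1] moments[of 2] moments[of 3] by (simp_all add: m1_def m2_def m3_def)
  have m1: "0 < m1" using assms(4) by (simp add: m1_def)
  have mg1: "mg1 L lam" if "0 < lam" for lam
  proof (rule mg1.intro)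
    show "prob_space L" unfolding L_def by (rule M.prob_space_distr) simp
    show "AE a in L. 0 \<le> a" unfolding L_def using assms(3) by (subst AE_distr_iff) auto
    show "integrable L (\<lambda>a. a ^ 3)" unfolding L_def using assms(5) by (subst integrable_distr_eq) auto
  qed (use that in \<open>simp_all add: L_def\<close>)
  interpret L: mg1 L 1 by (rule mg1) simp
  \<comment> \<open>The variance is nonnegative, so the second moment dominates the square of the
    positive mean.\<close>
  have "0 \<le> m2 - m1\<^sup>2"
    using L.L.variance_eq[OF L.integrable_L_id L.integrable_L_sq] L.L.variance_positive[of "\<lambda>a. a"]
    by (simp add: L1 L2)
  moreover have "0 < m1\<^sup>2" using m1 by simp
  ultimately have m2: "0 < m2" by linarith
  define m where "m = (\<integral>a. a ^ 3 * exp (- a) \<partial>L)"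
  have m: "0 < m"
  proof -
    have nn: "AE a in L. 0 \<le> a ^ 3 * exp (- a)"
      using L.L_nonneg by eventually_elim simp
    have int: "integrable L (\<lambda>a. a ^ 3 * exp (- a))"
      by (rule Bochner_Integration.integrable_bound[OF L.L_int3])
         (use L.L_nonneg in \<open>auto elim!: eventually_mono simp: abs_mult mult_left_le\<close>)
    \<comment> \<open>Were the tilted third moment zero, the service time would vanish almost
      surely, against its positive mean.\<close>
    have "m \<noteq> 0"
    proof
      assume "m = 0"
      then have "AE a in L. a ^ 3 * exp (- a) = 0"
        using integral_nonneg_eq_0_iff_AE[OF int nn] by (simp add: m_def)
      then have "(\<integral>a. a \<partial>L) = (\<integral>a. 0 \<partial>L)"
        by (intro integral_cong_AE) auto
      with m1 L1 show False by simp
    qed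
    moreover have "0 \<le> m" unfolding m_def by (rule integral_nonneg_AE[OF nn])
    ultimately show ?thesis by simp
  qed
  have stable: "stable_mg1 L lam" if "0 < lam" "lam * m1 < 1" for lam
    using mg1[OF that(1)] that(2) by (simp add: stable_mg1_def stable_mg1_axioms_def L1)
  define \<alpha> where "\<alpha> lam = lam * m2 / (2 * (1 - lam * m1))" for lam
  have dists:
    "dist_hat M S lam = wasserstein (law (queue_space M S lam) (\<lambda>\<omega>. lam * m1 / \<alpha> lam * waiting_time \<omega>)) (exp_law 1)"
    "dist_tilde M S lam = wasserstein (law (queue_space M S lam) (\<lambda>\<omega>. 1 / \<alpha> lam * waiting_time \<omega>)) (exp_law 1)"
    if "0 < lam" "lam * m1 < 1" for lam
  proof -
    have "W_hat M S lam = (\<lambda>\<omega>. lam * m1 / \<alpha> lam * waiting_time \<omega>)"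
      using that m1 m2 by (auto simp: W_hat_def load_def \<alpha>_def m1_def[symmetric] m2_def[symmetric] field_simps)
    then show "dist_hat M S lam = wasserstein (law (queue_space M S lam) (\<lambda>\<omega>. lam * m1 / \<alpha> lam * waiting_time \<omega>)) (exp_law 1)"
      by (simp add: dist_hat_def)
    have "W_tilde M S lam = (\<lambda>\<omega>. 1 / \<alpha> lam * waiting_time \<omega>)"
      using that m1 m2
      by (auto simp: W_tilde_def W_hat_def load_def \<alpha>_def m1_def[symmetric] m2_def[symmetric] field_simps)
    then show "dist_tilde M S lam = wasserstein (law (queue_space M S lam) (\<lambda>\<omega>. 1 / \<alpha> lam * waiting_time \<omega>)) (exp_law 1)"
      by (simp add: dist_tilde_def)
  qed
  have Q: "queue_space M S lam = (\<Pi>\<^sub>M j\<in>UNIV. L) \<Otimes>\<^sub>M (\<Pi>\<^sub>M j\<in>UNIV. exp_law lam)" for lam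
    by (simp add: queue_space_def L_def)
  have upper_lower: "dist_tilde M S lam \<le> ereal (bound_const M S * ((1 - \<rho>) / \<rho>)) \<and>
             ereal (1 - \<rho>) \<le> dist_hat M S lam \<and>
             dist_hat M S lam \<le> ereal ((1 + bound_const M S) * (1 - \<rho>))"
    if lam: "0 < lam" and \<rho>: "\<rho> = load M S lam" "0 < \<rho>" "\<rho> < 1" for lam \<rho>
  proof -
    have \<rho>_eq: "\<rho> = lam * m1" using \<rho>(1) by (simp add: load_def m1_def)
    with \<rho>(3) have st: "lam * m1 < 1" by simp
    interpret stable_mg1 L lam by (rule stable[OF lam st])
    have bc: "bound_const M S = 4 * m3 * m1 / (3 * m2\<^sup>2)"
      by (simp add: bound_const_def m1_def m2_def m3_def)
    note up = wasserstein_scaled_le[unfolded L1 L2 L3, folded \<alpha>_def Q, OF m2]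
    have "4 * m3 / (3 * lam * m2\<^sup>2) * (1 - lam * m1) = bound_const M S * ((1 - \<rho>) / \<rho>)"
      using lam m1 m2 by (simp add: bc \<rho>_eq field_simps)
    with up[of 1] have "dist_tilde M S lam \<le> ereal (bound_const M S * ((1 - \<rho>) / \<rho>))"
      unfolding dists(2)[OF lam st] by simp
    moreover have "\<rho> * (4 * m3 / (3 * lam * m2\<^sup>2) * (1 - lam * m1)) + (1 - \<rho>) = (1 + bound_const M S) * (1 - \<rho>)"
      using lam m1 m2 by (simp add: bc \<rho>_eq field_simps)
    with up[of "lam * m1"] \<rho>(2,3) have "dist_hat M S lam \<le> ereal ((1 + bound_const M S) * (1 - \<rho>))"
      unfolding dists(1)[OF lam st] \<rho>_eq by (simp only: less_imp_le)
    moreover have "ereal (1 - \<rho>) \<le> dist_hat M S lam"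
      using wasserstein_scaled_ge_mean[unfolded L1 L2 L3, folded \<alpha>_def Q, OF m2, of \<rho>] \<rho>
      unfolding dists(1)[OF lam st] by (simp add: \<rho>_eq)
    ultimately show ?thesis by blast
  qed
  define c where "c = m * m1 / (6 * m2\<^sup>2)"
  have c: "0 < c" using m m1 m2 by (simp add: c_def)
  \<comment> \<open>The window is chosen to give \<open>1 \<le> \<alpha> lam\<close>: the second
    bound makes \<open>2 * (1 - \<rho>)\<close> at most \<open>m2 / (2 * m1)\<close>, and
    \<open>\<rho> > 1 / 2\<close> makes \<open>lam * m2\<close> at least that.\<close>
  have "\<forall>\<^sub>F \<rho> in at_left (1::real). \<rho> \<in> {max (1 / 2) (1 - m2 / (4 * m1))<..<1}"
    using m1 m2 by (intro eventually_at_left_real) auto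
  then have "\<forall>\<^sub>F \<rho> in at_left (1::real). ereal (c * (1 - \<rho>)) \<le> dist_tilde M S (\<rho> / m1)"
  proof eventually_elim
    case (elim \<rho>)
    define lam where "lam = \<rho> / m1"
    have lam: "0 < lam" and \<rho>: "lam * m1 = \<rho>" using elim m1 by (auto simp: lam_def)
    have st: "lam * m1 < 1" using elim \<rho> by simp
    interpret stable_mg1 L lam by (rule stable[OF lam st])
    have "2 * (1 - \<rho>) \<le> m2 / (2 * m1)" using elim m1 by (simp add: field_simps)
    also have "\<dots> \<le> lam * m2" using elim m1 m2 by (simp add: lam_def field_simps)
    finally have "1 \<le> \<alpha> lam" using elim by (simp add: \<alpha>_def \<rho> field_simps)
    then have "ereal (m * (1 - \<rho>) / (6 * lam * m2\<^sup>2)) \<le> dist_tilde M S lam"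
      unfolding dists(2)[OF lam st]
      using wasserstein_ge_laplace[unfolded L1 L2 L3, folded \<alpha>_def Q m_def, OF m2] by (simp add: \<rho>)
    \<comment> \<open>Since \<open>lam\<close> stays below its limiting value \<open>1 / m1\<close>,
      putting that value in the denominator gives a constant independent of the load.\<close>
    moreover have "c * (1 - \<rho>) \<le> m * (1 - \<rho>) / (6 * lam * m2\<^sup>2)"
    proof -
      have "c * (1 - \<rho>) = m * (1 - \<rho>) / (6 * (1 / m1) * m2\<^sup>2)"
        using m1 by (simp add: c_def)
      also have "\<dots> \<le> m * (1 - \<rho>) / (6 * lam * m2\<^sup>2)"
        using elim m m1 m2 lam
        by (intro divide_left_mono mult_right_mono mult_left_mono mult_nonneg_nonneg)
           (auto simp: lam_def divide_right_mono)
      finally show ?thesis .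
    qed
    ultimately show ?case unfolding lam_def[symmetric] by (meson ereal_less_eq(3) order_trans)
  qed
  with c upper_lower show ?thesis unfolding m1_def by blast
qed

end
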